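(* For $r=3$, as $n\to\infty$, \[ \frac{1}{n-r+1}\binom{n}{r}\bigl(\ln(n-r+1) - 2 + o(1)\bigr) \le \ln p(n,r), \] and for all sufficiently large $n$, \[ \ln p(n,r) \le \frac{1}{n-r+1}\binom{n}{r}\bigl(\ln(n-r+1) + 0.35\bigr). \]
   Context: A matroid of rank $r$ on ground set $E$ is paving if every subset $F\subseteq E$ with $|F|<r$ is independent. $p(n,r)$ denotes the number of paving matroids of rank $r$ on the ground set $[n]=\{1,\dots,n\}$. *)

theory Defs
  imports Complex_Main "HOL-Library.Landau_Symbols"
begin

definition matroid :: "'a set \<Rightarrow> 'a set set \<Rightarrow> bool" where
  "matroid E \<I> \<longleftrightarrow>
     finite E \<and>
     (\<forall>X\<in>\<I>. X \<subseteq> E) \<and>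
     {} \<in> \<I> \<and>
     (\<forall>X\<in>\<I>. \<forall>Y. Y \<subseteq> X \<longrightarrow> Y \<in> \<I>) \<and>
     (\<forall>X\<in>\<I>. \<forall>Y\<in>\<I>. card X < card Y \<longrightarrow> (\<exists>y\<in>Y - X. insert y X \<in> \<I>))"

definition matroid_rank :: "'a set set \<Rightarrow> nat" where
  "matroid_rank \<I> = Max (card ` \<I>)"

definition paving_matroid :: "'a set \<Rightarrow> 'a set set \<Rightarrow> bool" where
  "paving_matroid E \<I> \<longleftrightarrow>
     matroid E \<I> \<and> (\<forall>F\<subseteq>E. card F < matroid_rank \<I> \<longrightarrow> F \<in> \<I>)"

text \<open>On a fixed ground set a matroid is determined by its family of independent sets,
  so labelled matroids (not isomorphism classes) are counted by counting such families.\<close>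

definition num_paving :: "nat \<Rightarrow> nat \<Rightarrow> nat" where
  "num_paving n r = card {\<I>. paving_matroid {1..n} \<I> \<and> matroid_rank \<I> = r}"

end

theory Submission
  imports Defs "HOL-Real_Asymp.Real_Asymp"
begin

text \<open>
  A rank-3 paving matroid is a linear space: its dependent triples partition the pairs of points
  into lines.

  For the upper bound, linear spaces are described by repeatedly specifying the whole line \<open>L\<close>
  through some pair whose line is still unknown. Giving every pair the weight \<open>z = (x / n)\<^bsup>1/3\<^esup>\<close>, the
  weights \<open>z\<close> to the power \<open>card L choose 2\<close> of the possible lines through a pair add up to
  \<open>x + x\<^sup>2/2 + o(1)\<close>, the main contributions being lines of size 3 and 4. If this is at most 1, there
  are at most \<open>z\<close> to the power \<open>- (n choose 2)\<close> linear spaces, and \<open>x = 0.72\<close> is admissible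
  with \<open>- ln x < 0.34\<close>.

  For the lower bound, every partial Steiner triple system gives a paving matroid, and these are
  counted by the random greedy triangle removal process on the complete graph. While a fraction
  \<open>p\<close> of the pairs is uncovered, all codegrees stay close to \<open>p\<^sup>2 n\<close>, so there are about \<open>p\<^sup>3 n\<^sup>3/6\<close>
  choices for the next triple. This can be followed until \<open>p\<close> is a small negative power of \<open>n\<close>;
  multiplying the numbers of choices and dividing by the number of orderings gives the bound.
\<close>

section \<open>Upper bound\<close>

definition pairs :: "'a set \<Rightarrow> 'a set set" where
  "pairs A = {e. e \<subseteq> A \<and> card e = 2}"

lemma finite_pairs [simp]: "finite A \<Longrightarrow> finite (pairs A)"
  by (rule finite_subset [of _ "Pow A"]) (auto simp: pairs_def)

lemma choose_two_real: "real (n choose 2) = real n * (real n - 1) / 2"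
  by (simp add: binomial_gbinomial gbinomial_prod_rev numeral_eq_Suc)

lemma card_pairs: "finite A \<Longrightarrow> card (pairs A) = card A choose 2"
  by (simp add: pairs_def n_subsets)

lemma pairs_mono: "A \<subseteq> B \<Longrightarrow> pairs A \<subseteq> pairs B"
  by (auto simp: pairs_def)

lemma doubleton_in_pairs: "{u, v} \<in> pairs A \<longleftrightarrow> u \<in> A \<and> v \<in> A \<and> u \<noteq> v"
  by (auto simp: pairs_def card_insert_if)

lemma pairsE:
  assumes "e \<in> pairs A"
  obtains u v where "e = {u, v}" "u \<noteq> v" "u \<in> A" "v \<in> A"
  using assms by (auto simp: pairs_def card_2_iff)

definition linear_space :: "'a set \<Rightarrow> 'a set set \<Rightarrow> bool" where
  "linear_space V D \<longleftrightarrow> (\<forall>T\<in>D. T \<subseteq> V \<and> card T = 3) \<and>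
     (\<forall>u v w x. {u, v, w} \<in> D \<longrightarrow> {u, v, x} \<in> D \<longrightarrow> w \<noteq> x \<longrightarrow> {u, w, x} \<in> D)"

definition line :: "'a set set \<Rightarrow> 'a set \<Rightarrow> 'a set" where
  "line D e = e \<union> {w. insert w e \<in> D}"

lemma in_line_doubleton: "x \<in> line D {u, v} \<longleftrightarrow> x = u \<or> x = v \<or> {u, v, x} \<in> D"
proof -
  have "insert x {u, v} = {u, v, x}" by auto
  thus ?thesis by (simp add: line_def disj_assoc)
qed

lemma line_exchange_subset:
  assumes D: "linear_space V D" and uv: "u \<noteq> v" and w: "w \<in> line D {u, v}" "w \<noteq> u"
  shows "line D {u, v} \<subseteq> line D {u, w}"
proof (cases "w = v")
  case False
  hence w': "{u, v, w} \<in> D" using w by (simp add: in_line_doubleton)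
  moreover have "{u, w, v} = {u, v, w}" by auto
  moreover have "{u, w, x} \<in> D" if "{u, v, x} \<in> D" "w \<noteq> x" for x
    using D w' that unfolding linear_space_def by blast
  ultimately show ?thesis unfolding subset_iff in_line_doubleton by metis
qed auto

lemma line_exchange:
  assumes D: "linear_space V D" and uv: "u \<noteq> v" and w: "w \<in> line D {u, v}" "w \<noteq> u"
  shows "line D {u, w} = line D {u, v}"
proof
  show "line D {u, v} \<subseteq> line D {u, w}" using line_exchange_subset[OF assms] .
  moreover have "v \<in> line D {u, v}" by (simp add: line_def)
  ultimately have "v \<in> line D {u, w}" by auto
  thus "line D {u, w} \<subseteq> line D {u, v}"
    using line_exchange_subset[OF D, of u w v] w uv by auto
qed

lemma line_eq:
  assumes D: "linear_space V D" and e: "e \<in> pairs V" and f: "f \<in> pairs (line D e)"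
  shows "line D f = line D e"
proof -
  obtain u v where uv: "e = {u, v}" "u \<noteq> v" using e by (elim pairsE) auto
  obtain x y where xy: "f = {x, y}" "x \<noteq> y" "x \<in> line D e" "y \<in> line D e"
    using f by (elim pairsE) auto
  show ?thesis
  proof (cases "x = u")
    case True
    thus ?thesis using line_exchange[OF D uv(2), of y] uv xy by auto
  next
    case False
    have ux: "line D {u, x} = line D e"
      using line_exchange[OF D uv(2), of x] uv xy False by auto
    hence "y \<in> line D {x, u}" using xy by (simp add: insert_commute)
    hence "line D {x, y} = line D {x, u}"
      using line_exchange[OF D, of x u y] False xy by auto
    thus ?thesis using ux xy by (simp add: insert_commute)
  qed
qed

lemma line_subset: "linear_space V D \<Longrightarrow> e \<in> pairs V \<Longrightarrow> line D e \<subseteq> V"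
  by (auto simp: line_def linear_space_def pairs_def)

lemma finite_linear_spaces: "finite V \<Longrightarrow> finite {D. linear_space V D}"
  by (rule finite_subset [of _ "Pow (Pow V)"]) (auto simp: linear_space_def)

text \<open>\<open>U\<close> is the set of pairs whose line is not yet known. Splitting \<open>C\<close> according to the line
  \<open>L\<close> through one pair of \<open>U\<close> determines all pairs of \<open>L\<close> at once; \<open>z\<close> is the weight of a pair,
  and the hypothesis on \<open>z\<close> is a Kraft inequality.\<close>

lemma card_partially_determined_linear_spaces_le:
  fixes z :: real
  assumes V: "finite V" and z: "z > 0"
    and kraft: "\<And>e. e \<in> pairs V \<Longrightarrow> (\<Sum>L | e \<subseteq> L \<and> L \<subseteq> V. z ^ card (pairs L)) \<le> 1"
    and "U \<subseteq> pairs V" "C \<subseteq> {D. linear_space V D}"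
    and "\<And>D D' T. D \<in> C \<Longrightarrow> D' \<in> C \<Longrightarrow> card T = 3 \<Longrightarrow> \<not> pairs T \<subseteq> U \<Longrightarrow> T \<in> D \<Longrightarrow> T \<in> D'"
    and "\<And>D e. D \<in> C \<Longrightarrow> e \<in> U \<Longrightarrow> pairs (line D e) \<subseteq> U"
  shows "real (card C) * z ^ card U \<le> 1"
  using assms(4-)
proof (induction "card U" arbitrary: U C rule: less_induct)
  case less
  note U = less.prems(1) and C = less.prems(2) and agree = less.prems(3) and closed = less.prems(4)
  have finU: "finite U" using U V finite_subset finite_pairs by blast
  have finC: "finite C" using C finite_linear_spaces[OF V] finite_subset by blast
  show ?case
  proof (cases "U = {}")
    case True
    have "D \<subseteq> D'" if "D \<in> C" "D' \<in> C" for D D'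
    proof
      fix T assume T: "T \<in> D"
      have T3: "card T = 3" using C that T by (auto simp: linear_space_def)
      have "card (pairs T) = 3 choose 2"
        using T3 card_pairs[of T] by (metis card.infinite zero_neq_numeral)
      hence "pairs T \<noteq> {}" by (auto simp: numeral_eq_Suc)
      thus "T \<in> D'" using agree[OF that T3 _ T] True by auto
    qed
    hence "card C \<le> 1" by (simp add: card_le_Suc0_iff_eq[OF finC] set_eq_subset)
    thus ?thesis using True by simp
  next
    case False
    then obtain e where e: "e \<in> U" by auto
    have eV: "e \<in> pairs V" using e U by auto
    define F where "F = {L. e \<subseteq> L \<and> L \<subseteq> V}"
    have finF: "finite F" unfolding F_def by (rule finite_subset[of _ "Pow V"]) (auto simp: V)
    define CL where "CL L = {D \<in> C. line D e = L}" for L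
    have part: "C = (\<Union>L\<in>F. CL L)"
      using C line_subset[OF _ eV] by (auto simp: F_def CL_def) (auto simp: line_def)
    have "card C \<le> (\<Sum>L\<in>F. card (CL L))"
      using card_UN_le[OF finF, of CL] part by simp
    hence "real (card C) * z ^ card U \<le> (\<Sum>L\<in>F. real (card (CL L))) * z ^ card U"
      using z by (intro mult_right_mono) (auto simp flip: of_nat_sum)
    also have "\<dots> = (\<Sum>L\<in>F. real (card (CL L)) * z ^ card U)" by (simp add: sum_distrib_right)
    also have "\<dots> \<le> (\<Sum>L\<in>F. z ^ card (pairs L))"
    proof (rule sum_mono)
      fix L assume L: "L \<in> F"
      show "real (card (CL L)) * z ^ card U \<le> z ^ card (pairs L)"
      proof (cases "CL L = {}")
        case True
        thus ?thesis using z by simp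
      next
        case False
        have LU: "pairs L \<subseteq> U" using False closed[OF _ e] by (auto simp: CL_def)
        have eL: "e \<in> pairs L" using L eV by (auto simp: F_def pairs_def)
        have finL: "finite (pairs L)" using LU finU finite_subset by blast
        have cU: "card U = card (U - pairs L) + card (pairs L)"
          using LU finU card_mono[OF finU LU] by (simp add: card_Diff_subset finL)
        have "card (pairs L) > 0" using eL finL card_gt_0_iff by blast
        have lin: "linear_space V D" and lineL: "line D e = L" if "D \<in> CL L" for D
          using that C by (auto simp: CL_def)
        have "real (card (CL L)) * z ^ card (U - pairs L) \<le> 1"
        proof (rule less.hyps)
          show "card (U - pairs L) < card U" using cU \<open>card (pairs L) > 0\<close> by simp
          show "U - pairs L \<subseteq> pairs V" using U by auto
          show "CL L \<subseteq> {D. linear_space V D}" using C by (auto simp: CL_def)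
        next
          fix D D' T
          assume D: "D \<in> CL L" "D' \<in> CL L" and T: "card T = 3" "\<not> pairs T \<subseteq> U - pairs L" "T \<in> D"
          show "T \<in> D'"
          proof (cases "pairs T \<subseteq> U")
            case False
            thus ?thesis using agree[of D D' T] D T by (auto simp: CL_def)
          next
            case True
            then obtain f where f: "f \<in> pairs T" "f \<in> pairs L" using T by auto
            have "card (T - f) = 1" 
              using f T by (subst card_Diff_subset) (auto simp: pairs_def intro: card_ge_0_finite)
            then obtain w where "T - f = {w}" by (auto simp: card_1_singleton_iff)
            hence w: "T = insert w f" "w \<notin> f" using f by (auto simp: pairs_def)
            have lf: "line D f = L" "line D' f = L"
              using line_eq[OF lin eV, of _ f] D lineL f by auto
            have "w \<in> line D f" using w T by (auto simp: line_def)
            hence "w \<in> line D' f" using lf by simp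
            thus ?thesis using w by (auto simp: line_def)
          qed
        next
          fix D f assume D: "D \<in> CL L" and f: "f \<in> U - pairs L"
          have "pairs (line D f) \<subseteq> U" using closed[of D f] D f by (auto simp: CL_def)
          moreover have "g \<notin> pairs L" if "g \<in> pairs (line D f)" for g
          proof
            assume g: "g \<in> pairs L"
            have "line D g = line D f" using line_eq[OF lin[OF D] _ that] f U by auto
            moreover have "line D g = L" using line_eq[OF lin[OF D] eV] g lineL[OF D] by auto
            ultimately have "f \<subseteq> L" by (auto simp: line_def)
            thus False using f U by (auto simp: pairs_def)
          qed
          ultimately show "pairs (line D f) \<subseteq> U - pairs L" by auto
        qed
        thus ?thesis using z by (simp add: cU power_add mult.assoc[symmetric])
      qed
    qed
    also have "\<dots> \<le> 1" using kraft[OF eV] by (simp add: F_def)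
    finally show ?thesis .
  qed
qed

lemma card_linear_spaces_le:
  fixes z :: real
  assumes V: "finite V" and z: "z > 0"
    and kraft: "\<And>e. e \<in> pairs V \<Longrightarrow> (\<Sum>L | e \<subseteq> L \<and> L \<subseteq> V. z ^ card (pairs L)) \<le> 1"
  shows "real (card {D. linear_space V D}) * z ^ (card V choose 2) \<le> 1"
  unfolding card_pairs[OF V, symmetric]
proof (rule card_partially_determined_linear_spaces_le[OF V z kraft])
  fix D D' T assume *: "D \<in> {D. linear_space V D}" "\<not> pairs T \<subseteq> pairs V" "T \<in> D"
  hence "T \<subseteq> V" by (auto simp: linear_space_def)
  thus "T \<in> D'" using * pairs_mono by blast
next
  fix D e assume "D \<in> {D. linear_space V D}" "e \<in> pairs V"
  thus "pairs (line D e) \<subseteq> pairs V" using line_subset by (blast intro: pairs_mono[THEN subsetD])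
qed auto

definition dependent_triples :: "'a set \<Rightarrow> 'a set set \<Rightarrow> 'a set set" where
  "dependent_triples V I = {T. T \<subseteq> V \<and> card T = 3 \<and> T \<notin> I}"

lemma paving_matroidD:
  assumes "paving_matroid V I"
  shows "finite V" "X \<in> I \<Longrightarrow> X \<subseteq> V" "F \<subseteq> V \<Longrightarrow> card F < matroid_rank I \<Longrightarrow> F \<in> I"
    "X \<in> I \<Longrightarrow> Y \<in> I \<Longrightarrow> card X < card Y \<Longrightarrow> \<exists>y\<in>Y - X. insert y X \<in> I"
  using assms unfolding paving_matroid_def matroid_def by blast+

lemma paving_rank3_eq:
  assumes "paving_matroid V I" "matroid_rank I = 3"
  shows "I = {X. X \<subseteq> V \<and> (card X < 3 \<or> card X = 3 \<and> X \<notin> dependent_triples V I)}"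
proof -
  have V: "finite V" and sub: "\<And>X. X \<in> I \<Longrightarrow> X \<subseteq> V"
    using paving_matroidD(1,2)[OF assms(1)] by auto
  have "finite I" by (rule finite_subset[of _ "Pow V"]) (use sub V in auto)
  hence le3: "card X \<le> 3" if "X \<in> I" for X
    using assms(2) that by (metis Max_ge finite_imageI imageI matroid_rank_def)
  have small: "X \<in> I" if "X \<subseteq> V" "card X < 3" for X
    using paving_matroidD(3)[OF assms(1)] assms(2) that by auto
  have "X \<in> I \<longleftrightarrow> X \<subseteq> V \<and> (card X < 3 \<or> card X = 3 \<and> X \<notin> dependent_triples V I)" for X
    using sub[of X] le3[of X] small[of X]
    by (cases "card X" "3::nat" rule: linorder_cases) (auto simp: dependent_triples_def)
  thus ?thesis by blast
qed

lemma linear_space_dependent_triples: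
  assumes "paving_matroid V I" "matroid_rank I = 3"
  shows "linear_space V (dependent_triples V I)"
  unfolding linear_space_def
proof (intro conjI allI impI ballI)
  fix u v w x assume uvw: "{u, v, w} \<in> dependent_triples V I" and uvx: "{u, v, x} \<in> dependent_triples V I"
    and wx: "w \<noteq> x"
  have d: "u \<noteq> v" "u \<noteq> w" "v \<noteq> w" "u \<noteq> x" "v \<noteq> x"
    using uvw uvx by (auto simp: dependent_triples_def card_insert_if split: if_splits)
  have "{u, v} \<subseteq> V" using uvw by (auto simp: dependent_triples_def)
  hence "{u, v} \<in> I" using paving_matroidD(3)[OF assms(1)] assms(2) d by auto
  have "{u, w, x} \<notin> I"
  proof
    assume "{u, w, x} \<in> I"
    from paving_matroidD(4)[OF assms(1) \<open>{u, v} \<in> I\<close> this] obtain y where "y \<in> {w, x}" "insert y {u, v} \<in> I"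
      using d wx by auto
    thus False using uvw uvx by (auto simp: dependent_triples_def insert_commute)
  qed
  thus "{u, w, x} \<in> dependent_triples V I"
    using uvw uvx d wx by (auto simp: dependent_triples_def)
qed (auto simp: dependent_triples_def)

lemma num_paving_3_le: "num_paving n 3 \<le> card {D. linear_space {1..n} D}"
  unfolding num_paving_def
proof (rule card_inj_on_le[where f = "dependent_triples {1..n}"])
  show "inj_on (dependent_triples {1..n}) {I. paving_matroid {1..n} I \<and> matroid_rank I = 3}"
  proof (rule inj_onI)
    fix I J
    assume I: "I \<in> {I. paving_matroid {1..n} I \<and> matroid_rank I = 3}" 
      and J: "J \<in> {I. paving_matroid {1..n} I \<and> matroid_rank I = 3}"
      and eq: "dependent_triples {1..n} I = dependent_triples {1..n} J"
    show "I = J"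
      using paving_rank3_eq[of "{1..n}" I] paving_rank3_eq[of "{1..n}" J] I J eq by simp
  qed
qed (auto intro: linear_space_dependent_triples finite_linear_spaces)

lemma sum_supersets_by_card:
  fixes g :: "nat \<Rightarrow> real"
  assumes V: "finite V" and e: "e \<subseteq> V"
  shows "(\<Sum>L | e \<subseteq> L \<and> L \<subseteq> V. g (card L)) =
    (\<Sum>j\<le>card (V - e). real (card (V - e) choose j) * g (j + card e))"
proof -
  have fe: "finite e" using e V finite_subset by blast
  have "(\<Sum>L | e \<subseteq> L \<and> L \<subseteq> V. g (card L)) = (\<Sum>A\<in>Pow (V - e). g (card A + card e))"
  proof (rule sum.reindex_bij_witness[where i = "\<lambda>A. A \<union> e" and j = "\<lambda>L. L - e"])
    fix L assume "L \<in> {L. e \<subseteq> L \<and> L \<subseteq> V}"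
    hence "finite L" "e \<subseteq> L" using V finite_subset by auto
    thus "g (card (L - e) + card e) = g (card L)"
      using fe card_mono[of L e] by (simp add: card_Diff_subset)
  qed (use e in auto)
  also have "\<dots> = (\<Sum>j\<le>card (V - e). \<Sum>A | A \<in> Pow (V - e) \<and> card A = j. g (card A + card e))"
    using V by (intro sum.group[symmetric]) (auto intro: card_mono)
  also have "\<dots> = (\<Sum>j\<le>card (V - e). real (card (V - e) choose j) * g (j + card e))"
    using V by (intro sum.cong refl) (simp add: n_subsets)
  finally show ?thesis .
qed

lemma kraft_sum_le:
  fixes x :: real and n :: nat
  defines "z \<equiv> (x / real n) powr (1/3)"
  assumes n: "n \<ge> 2" and x: "0 < x" "x \<le> 1"
  shows "(\<Sum>j\<le>n - 2. real ((n - 2) choose j) * z ^ ((j + 2) choose 2)) \<le>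
    x + x\<^sup>2 / 2 + 4 * real n powr (-1/3)"
proof -
  have z0: "z > 0" using x n by (simp add: z_def)
  have z3: "z ^ 3 = x / n" using x n by (simp add: z_def powr_power)
  have zn: "z \<le> real n powr (-1/3)"
  proof -
    have "z \<le> (1 / real n) powr (1/3)"
      unfolding z_def using x n by (intro powr_mono2 divide_right_mono) auto
    also have "\<dots> = real n powr (-1/3)"
      using powr_minus_divide[of "real n" "1/3"] by (simp add: powr_divide)
    finally show ?thesis .
  qed
  define f where "f j = real ((n - 2) choose j) * z ^ ((j + 2) choose 2)" for j
  have choose2: "(j + 2) choose 2 = (j + 1) * (j + 2) div 2" for j :: nat
    by (simp add: choose_two mult.commute)
  have fj: "f j \<le> (1 / fact j) * (real n ^ j * z ^ ((j + 2) choose 2))" for j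
  proof -
    have "real ((n - 2) choose j) \<le> real n ^ j / fact j"
    proof -
      have "real ((n - 2) choose j) * fact j \<le> real ((n-2) ^ j)"
        using binomial_fact_pow[of "n-2" j] by (metis of_nat_fact of_nat_le_iff of_nat_mult)
      also have "\<dots> \<le> real n ^ j" by (simp add: power_mono)
      finally show ?thesis by (simp add: field_simps)
    qed
    from mult_right_mono[OF this, of "z ^ ((j + 2) choose 2)"] show ?thesis
      using z0 by (simp add: f_def)
  qed
  have f0: "f 0 \<le> real n powr (-1/3)" using zn by (simp add: f_def numeral_2_eq_2)
  have f1: "f 1 \<le> x" 
  proof -
    have "((1 + 2) choose 2) = (3 :: nat)" unfolding choose2 by simp
    thus ?thesis using fj[of 1] n by (simp only: z3) simp
  qed
  have "z ^ 6 = (x / n)\<^sup>2" using z3 by (metis mult_2 numeral_Bit0 power2_eq_square power_add)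
  hence f2: "f 2 \<le> x\<^sup>2 / 2"
    using fj[of 2] n unfolding choose2 by (simp add: power_divide)
  have f3: "f j \<le> (1 / fact j) * real n powr (-1/3)" if "j \<ge> 3" for j
  proof -
    have ev: "even ((j + 1) * (j + 2))" by simp
    have "z ^ ((j + 2) choose 2) \<le> (real n powr (-1/3)) ^ ((j + 2) choose 2)"
      using z0 zn by (intro power_mono) auto
    also have "\<dots> = real n powr (-(real ((j+1) * (j+2) div 2) / 3))"
    proof -
      have "(real n powr (-1/3)) ^ k = real n powr (-(real k / 3))" for k
        using n by (simp add: powr_power)
      thus ?thesis unfolding choose2 .
    qed
    also have "real ((j+1) * (j+2) div 2) = (real j + 1) * (real j + 2) / 2"
      using ev by (subst real_of_nat_div) (auto simp: algebra_simps)
    finally have "real n ^ j * z ^ ((j + 2) choose 2) \<le>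
        real n powr j * real n powr (-((real j + 1) * (real j + 2) / 2 / 3))"
      using n by (simp add: powr_realpow mult_left_mono)
    also have "\<dots> = real n powr (-((real j - 1) * (real j - 2) / 6))"
      unfolding powr_add[symmetric] by (rule arg_cong[where f = "\<lambda>a. real n powr a"]) (simp add: field_simps)
    also have "\<dots> \<le> real n powr (-1/3)"
    proof (rule powr_mono)
      have "2 * 1 \<le> (real j - 1) * (real j - 2)" using that by (intro mult_mono) auto
      thus "-((real j - 1) * (real j - 2) / 6) \<le> -1/3" by simp
    qed (use n in auto)
    finally have *: "real n ^ j * z ^ ((j + 2) choose 2) \<le> real n powr (-1/3)" .
    show ?thesis
      using fj[of j] mult_left_mono[OF *, of "1 / fact j"] by auto
  qed
  have f_nonneg: "f j \<ge> 0" for j using z0 by (simp add: f_def)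
  have "(\<Sum>j\<le>n - 2. f j) \<le> (\<Sum>j\<in>{0,1,2} \<union> {3..n-2}. f j)"
    using f_nonneg by (intro sum_mono2) auto
  also have "\<dots> = f 0 + f 1 + f 2 + (\<Sum>j\<in>{3..n-2}. f j)"
    by (subst sum.union_disjoint) auto
  also have "(\<Sum>j\<in>{3..n-2}. f j) \<le> (\<Sum>j\<in>{3..n-2}. (1 / fact j) * real n powr (-1/3))"
    by (intro sum_mono f3) auto
  also have "\<dots> = (\<Sum>j\<in>{3..n-2}. inverse (fact j)) * real n powr (-1/3)"
    by (simp add: sum_distrib_right inverse_eq_divide)
  also have "(\<Sum>j\<in>{3..n-2}. inverse (fact j)) \<le> (3 :: real)"
  proof -
    have s: "(\<lambda>j. inverse (fact j) :: real) sums exp 1"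
      using exp_converges[of "1::real"] by simp
    have "(\<Sum>j\<in>{3..n-2}. inverse (fact j)) \<le> (\<Sum>j. inverse (fact j) :: real)"
      using s by (intro sum_le_suminf) (auto simp: sums_iff)
    also have "\<dots> = exp 1" using s by (simp add: sums_iff)
    also have "\<dots> \<le> 3" using exp_le by simp
    finally show ?thesis .
  qed
  finally have "(\<Sum>j\<le>n - 2. f j) \<le> f 0 + f 1 + f 2 + 3 * real n powr (-1/3)"
    by (simp add: mult_right_mono)
  thus ?thesis using f0 f1 f2 by (simp add: f_def)
qed

lemma ln_num_paving_3_le:
  fixes x :: real
  assumes n: "n \<ge> 4" and x: "0 < x" "x \<le> 1"
    and small: "x + x\<^sup>2 / 2 + 4 * real n powr (-1/3) \<le> 1"
  shows "ln (real (num_paving n 3)) \<le> real n * (real n - 1) / 6 * (ln n - ln x)"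
proof -
  define z where "z = (x / real n) powr (1/3)"
  have z0: "z > 0" using x n by (simp add: z_def)
  have "(\<Sum>L | e \<subseteq> L \<and> L \<subseteq> {1..n}. z ^ card (pairs L)) \<le> 1" if e: "e \<in> pairs {1..n}" for e
  proof -
    have e': "e \<subseteq> {1..n}" "card e = 2" "finite e" using e by (auto simp: pairs_def intro: finite_subset)
    have "(\<Sum>L | e \<subseteq> L \<and> L \<subseteq> {1..n}. z ^ card (pairs L)) =
      (\<Sum>L | e \<subseteq> L \<and> L \<subseteq> {1..n}. z ^ (card L choose 2))"
      by (intro sum.cong refl) (auto simp: card_pairs finite_subset)
    also have "\<dots> = (\<Sum>j\<le>n - 2. real ((n - 2) choose j) * z ^ ((j + 2) choose 2))"
      using e' by (subst sum_supersets_by_card) (auto simp: card_Diff_subset)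
    also have "\<dots> \<le> 1" using kraft_sum_le[of n x] n x small by (simp add: z_def)
    finally show ?thesis .
  qed
  from card_linear_spaces_le[OF _ z0 this]
  have "real (card {D. linear_space {1..n} D}) * z ^ (n choose 2) \<le> 1" by simp
  hence "real (num_paving n 3) * z ^ (n choose 2) \<le> 1"
    using num_paving_3_le[of n] z0
    by (meson mult_right_mono of_nat_le_iff order_trans zero_le_power less_imp_le)
  hence le: "real (num_paving n 3) \<le> 1 / z ^ (n choose 2)" using z0 by (simp add: field_simps)
  have lnz: "ln z = (ln x - ln n) / 3" using x n by (simp add: z_def ln_powr ln_div)
  have n2: "real n * (real n - 1) / 6 = real (n choose 2) / 3" by (simp add: choose_two_real)
  have rhs: "ln (1 / z ^ (n choose 2)) = real n * (real n - 1) / 6 * (ln n - ln x)"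
    unfolding n2 using z0 by (simp add: ln_div ln_realpow lnz algebra_simps diff_divide_distrib)
  show ?thesis
  proof (cases "num_paving n 3 = 0")
    case True
    have "ln x \<le> 0" "0 \<le> ln (real n)" using x n by auto
    hence "0 \<le> ln (real n) - ln x" by linarith
    hence "0 \<le> real n * (real n - 1) / 6 * (ln n - ln x)" using n by (intro mult_nonneg_nonneg) auto
    thus ?thesis using True by simp
  next
    case False
    hence "ln (real (num_paving n 3)) \<le> ln (1 / z ^ (n choose 2))" using le z0 by simp
    thus ?thesis using rhs by simp
  qed
qed

lemma eventually_ln_num_paving_3_le:
  "\<forall>\<^sub>F n in at_top. ln (real (num_paving n 3)) \<le> real n * (real n - 1) / 6 * (ln (real n - 2) + 0.35)"
proof -
  have "exp (0.34 :: real) \<ge> 1 + 0.34 + 0.34\<^sup>2 / 2"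
    by (rule exp_lower_Taylor_quadratic) simp
  hence "exp (0.34 :: real) \<ge> 25/18" by (simp add: power2_eq_square)
  hence "ln (25/18 :: real) \<le> 0.34" by (metis exp_ge_zero exp_gt_zero ln_exp ln_mono zero_less_divide_iff zero_less_numeral)
  hence lnx: "- ln (18/25 :: real) \<le> 0.34" by (simp add: ln_div)
  have "(\<lambda>n. 4 * real n powr (-1/3)) \<longlonglongrightarrow> 0"
    by real_asymp
  hence "\<forall>\<^sub>F n in at_top. 4 * real n powr (-1/3) < 1/100"
    by (rule order_tendstoD) simp
  hence "\<forall>\<^sub>F n in at_top. 18/25 + (18/25 :: real)\<^sup>2 / 2 + 4 * real n powr (-1/3) \<le> 1"
    by eventually_elim (simp add: power2_eq_square)
  moreover have "\<forall>\<^sub>F n in at_top. ln (real n) + 0.34 \<le> ln (real n - 2) + 0.35"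
    by real_asymp
  ultimately show ?thesis
    using eventually_ge_at_top[of 4]
  proof eventually_elim
    case (elim n)
    have "ln (real (num_paving n 3)) \<le> real n * (real n - 1) / 6 * (ln n - ln (18/25))"
      using elim by (intro ln_num_paving_3_le) auto
    also have "\<dots> \<le> real n * (real n - 1) / 6 * (ln (real n - 2) + 0.35)"
      using elim lnx by (intro mult_left_mono) auto
    finally show ?case .
  qed
qed

section \<open>Triangles and packings\<close>

definition triangles :: "'a set set \<Rightarrow> 'a set set" where
  "triangles E = {T. card T = 3 \<and> pairs T \<subseteq> E}"

definition common_nbrs :: "'a set set \<Rightarrow> 'a \<Rightarrow> 'a \<Rightarrow> 'a set" where
  "common_nbrs E u v = {w. {u, w} \<in> E \<and> {v, w} \<in> E}"

lemma card_pairs_triangle: "card T = 3 \<Longrightarrow> card (pairs T) = 3"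
  using card_pairs[of T] card.infinite[of T] by (auto simp: choose_two)

lemma finite_pairs_triangle: "card T = 3 \<Longrightarrow> finite (pairs T)"
  by (intro finite_pairs card_ge_0_finite) simp

lemma triangle_subset:
  assumes "E \<subseteq> pairs V" "T \<in> triangles E"
  shows "T \<subseteq> V"
proof
  fix x assume x: "x \<in> T"
  have T: "card T = 3" "pairs T \<subseteq> E" using assms by (auto simp: triangles_def)
  hence "finite T" by (intro card_ge_0_finite) simp
  hence "card (T - {x}) = 2" using x T by simp
  hence "T - {x} \<noteq> {}" by force
  then obtain y where "y \<in> T - {x}" by blast
  hence "{x, y} \<in> pairs T" using x by (auto simp: doubleton_in_pairs)
  hence "{x, y} \<in> pairs V" using T assms by auto
  thus "x \<in> V" by (simp add: doubleton_in_pairs)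
qed

lemma edgeD:
  assumes "E \<subseteq> pairs V" "{u, v} \<in> E"
  shows "u \<noteq> v" "u \<in> V" "v \<in> V"
  using assms doubleton_in_pairs[of u v V] by auto

lemma finite_triangles: "finite V \<Longrightarrow> E \<subseteq> pairs V \<Longrightarrow> finite (triangles E)"
  by (rule finite_subset[of _ "Pow V"]) (use triangle_subset[of E V] in auto)

lemma common_nbrs_subset: "E \<subseteq> pairs V \<Longrightarrow> common_nbrs E u v \<subseteq> V - {u, v}"
proof
  fix w assume "E \<subseteq> pairs V" "w \<in> common_nbrs E u v"
  thus "w \<in> V - {u, v}"
    using edgeD[of E V u w] edgeD[of E V v w] by (auto simp: common_nbrs_def)
qed

lemma finite_common_nbrs: "finite V \<Longrightarrow> E \<subseteq> pairs V \<Longrightarrow> finite (common_nbrs E u v)"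
  by (metis common_nbrs_subset finite_Diff finite_subset)

lemma triple_in_triangles:
  assumes "u \<noteq> v" "u \<noteq> w" "v \<noteq> w"
  shows "{u, v, w} \<in> triangles E \<longleftrightarrow> {u, v} \<in> E \<and> {u, w} \<in> E \<and> {v, w} \<in> E"
proof -
  have "pairs {u, v, w} = {{u, v}, {u, w}, {v, w}}" (is "?L = ?R")
  proof
    show "?L \<subseteq> ?R" by (auto simp: pairs_def card_2_iff)
    show "?R \<subseteq> ?L" using assms by (auto simp: pairs_def)
  qed
  thus ?thesis using assms by (auto simp: triangles_def)
qed

lemma triangle_eq:
  assumes "card T = 3" "u \<in> T" "v \<in> T" "w \<in> T" "u \<noteq> v" "u \<noteq> w" "v \<noteq> w"
  shows "T = {u, v, w}"
proof -
  have "finite T" using assms(1) by (intro card_ge_0_finite) simp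
  thus ?thesis using assms by (intro card_subset_eq[symmetric]) auto
qed

lemma card_triangles_through:
  assumes E: "E \<subseteq> pairs V" and uv: "{u, v} \<in> E"
  shows "card {T \<in> triangles E. {u, v} \<subseteq> T} = card (common_nbrs E u v)"
proof -
  have "u \<noteq> v" using edgeD[OF E uv] by simp
  have ne: "w \<noteq> u" "w \<noteq> v" if "w \<in> common_nbrs E u v" for w
    using common_nbrs_subset[OF E] that by auto
  have "bij_betw (\<lambda>w. {u, v, w}) (common_nbrs E u v) {T \<in> triangles E. {u, v} \<subseteq> T}"
  proof (rule bij_betw_imageI)
    show "inj_on (\<lambda>w. {u, v, w}) (common_nbrs E u v)"
    proof (rule inj_onI)
      fix w x assume *: "w \<in> common_nbrs E u v" "x \<in> common_nbrs E u v" "{u, v, w} = {u, v, x}"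
      have "w \<in> {u, v, x}" using *(3) by blast
      thus "w = x" using ne[OF *(1)] by auto
    qed
    have "T \<in> (\<lambda>w. {u, v, w}) ` common_nbrs E u v"
      if T: "T \<in> triangles E" "u \<in> T" "v \<in> T" for T
    proof -
      have T3: "card T = 3" using T by (simp add: triangles_def)
      have "\<not> T \<subseteq> {u, v}"
      proof
        assume "T \<subseteq> {u, v}"
        hence "card T \<le> card {u, v}" by (intro card_mono) auto
        thus False using T3 \<open>u \<noteq> v\<close> by simp
      qed
      then obtain w where w: "w \<in> T" "w \<noteq> u" "w \<noteq> v" by auto
      have "T = {u, v, w}" using triangle_eq[OF T3 T(2,3) w(1)] w \<open>u \<noteq> v\<close> by auto
      moreover have "w \<in> common_nbrs E u v"
        using T(1) w \<open>u \<noteq> v\<close> calculation by (auto simp: triple_in_triangles common_nbrs_def)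
      ultimately show ?thesis by blast
    qed
    moreover have "{u, v, w} \<in> triangles E" if "w \<in> common_nbrs E u v" for w
      using that ne[OF that] uv \<open>u \<noteq> v\<close> by (auto simp: triple_in_triangles common_nbrs_def)
    ultimately show "(\<lambda>w. {u, v, w}) ` common_nbrs E u v = {T \<in> triangles E. {u, v} \<subseteq> T}"
      by auto
  qed
  thus ?thesis by (simp add: bij_betw_same_card)
qed

lemma sum_triangles_through_edges:
  assumes V: "finite V" and E: "E \<subseteq> pairs V"
  shows "(\<Sum>e\<in>E. card {T \<in> triangles E. e \<subseteq> T}) = 3 * card (triangles E)"
proof -
  have finE: "finite E" using V E finite_subset finite_pairs by blast
  have "(\<Sum>e\<in>E. card {T \<in> triangles E. e \<subseteq> T}) = (\<Sum>T\<in>triangles E. card {e \<in> E. e \<subseteq> T})"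
    by (rule sum_multicount_gen[symmetric]) (use finE finite_triangles[OF V E] in auto)
  also have "\<dots> = (\<Sum>T\<in>triangles E. 3)"
  proof (rule sum.cong[OF refl])
    fix T assume T: "T \<in> triangles E"
    have "{e \<in> E. e \<subseteq> T} = pairs T" using T E by (auto simp: triangles_def pairs_def)
    thus "card {e \<in> E. e \<subseteq> T} = 3" using T card_pairs_triangle by (auto simp: triangles_def)
  qed
  finally show ?thesis by simp
qed

definition lost_nbrs :: "'a set set \<Rightarrow> 'a \<Rightarrow> 'a \<Rightarrow> 'a set \<Rightarrow> 'a set" where
  "lost_nbrs E u v T = {w \<in> common_nbrs E u v. {u, w} \<subseteq> T \<or> {v, w} \<subseteq> T}"

lemma card_common_nbrs_remove:
  assumes V: "finite V" and E: "E \<subseteq> pairs V" and T: "T \<in> triangles E"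
  shows "card (common_nbrs E u v) = card (common_nbrs (E - pairs T) u v) + card (lost_nbrs E u v T)"
proof -
  have ne: "w \<noteq> u \<and> w \<noteq> v" if "w \<in> common_nbrs E u v" for w
    using common_nbrs_subset[OF E] that by auto
  have "common_nbrs E u v = common_nbrs (E - pairs T) u v \<union> lost_nbrs E u v T"
    using ne by (auto simp: lost_nbrs_def common_nbrs_def doubleton_in_pairs)
  moreover have "common_nbrs (E - pairs T) u v \<inter> lost_nbrs E u v T = {}"
    using ne by (auto simp: lost_nbrs_def common_nbrs_def doubleton_in_pairs)
  moreover have "finite (common_nbrs E u v)" using finite_common_nbrs[OF V E] .
  ultimately show ?thesis by (metis card_Un_disjoint finite_Un)
qed

lemma card_lost_nbrs_le:
  assumes E: "E \<subseteq> pairs V" and T: "T \<in> triangles E"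
  shows "card (lost_nbrs E u v T) \<le> 2"
proof (cases "lost_nbrs E u v T = {}")
  case False
  have T3: "card T = 3" "finite T" using T by (auto simp: triangles_def intro: card_ge_0_finite)
  have sub: "lost_nbrs E u v T \<subseteq> T - {u, v}"
    using common_nbrs_subset[OF E] by (auto simp: lost_nbrs_def)
  have "u \<in> T \<or> v \<in> T" using False by (auto simp: lost_nbrs_def)
  hence "T - {u, v} \<subset> T" by auto
  hence "card (T - {u, v}) < 3" using psubset_card_mono[of T "T - {u, v}"] T3 by auto
  moreover have "card (lost_nbrs E u v T) \<le> card (T - {u, v})"
    using sub T3 by (intro card_mono) auto
  ultimately show ?thesis by linarith
qed auto

lemma sum_card_lost_nbrs:
  assumes V: "finite V" and E: "E \<subseteq> pairs V" and uv: "u \<noteq> v"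
  defines "Y \<equiv> common_nbrs E"
  shows "(\<Sum>T\<in>triangles E. card (lost_nbrs E u v T)) \<le> (\<Sum>w\<in>Y u v. card (Y u w) + card (Y v w))"
    and "(\<Sum>w\<in>Y u v. card (Y u w) + card (Y v w)) \<le>
      (\<Sum>T\<in>triangles E. card (lost_nbrs E u v T)) + card (Y u v)"
proof -
  let ?A = "\<lambda>x w. {T \<in> triangles E. {x, w} \<subseteq> T}"
  have finT: "finite (triangles E)" using finite_triangles[OF V E] .
  have finY: "finite (Y u v)" unfolding Y_def using finite_common_nbrs[OF V E] .
  have swap: "(\<Sum>T\<in>triangles E. card (lost_nbrs E u v T)) = (\<Sum>w\<in>Y u v. card (?A u w \<union> ?A v w))"
  proof -
    have "(\<Sum>T\<in>triangles E. card (lost_nbrs E u v T)) =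
        (\<Sum>T\<in>triangles E. card {w \<in> Y u v. {u, w} \<subseteq> T \<or> {v, w} \<subseteq> T})"
      by (simp add: lost_nbrs_def Y_def)
    also have "\<dots> = (\<Sum>w\<in>Y u v. card {T \<in> triangles E. {u, w} \<subseteq> T \<or> {v, w} \<subseteq> T})"
      by (rule sum_multicount_gen) (use finT finY in auto)
    also have "\<dots> = (\<Sum>w\<in>Y u v. card (?A u w \<union> ?A v w))"
      by (intro sum.cong refl arg_cong[where f = card]) auto
    finally show ?thesis .
  qed
  have A: "card (?A u w) = card (Y u w)" "card (?A v w) = card (Y v w)" if "w \<in> Y u v" for w
    using card_triangles_through[OF E, of u w] card_triangles_through[OF E, of v w] that
    by (auto simp: Y_def common_nbrs_def)
  show "(\<Sum>T\<in>triangles E. card (lost_nbrs E u v T)) \<le> (\<Sum>w\<in>Y u v. card (Y u w) + card (Y v w))"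
    unfolding swap
  proof (rule sum_mono)
    fix w assume "w \<in> Y u v"
    thus "card (?A u w \<union> ?A v w) \<le> card (Y u w) + card (Y v w)"
      using A[of w] card_Un_le[of "?A u w" "?A v w"] by linarith
  qed
  have "card (Y u w) + card (Y v w) \<le> card (?A u w \<union> ?A v w) + 1" if w: "w \<in> Y u v" for w
  proof -
    have ne: "w \<noteq> u" "w \<noteq> v" using common_nbrs_subset[OF E] w by (auto simp: Y_def)
    have "?A u w \<inter> ?A v w \<subseteq> {{u, v, w}}"
      using triangle_eq[of _ u v w] uv ne by (auto simp: triangles_def)
    hence "card (?A u w \<inter> ?A v w) \<le> card {{u, v, w}}" by (intro card_mono) auto
    hence "card (?A u w \<inter> ?A v w) \<le> 1" by simp
    moreover have "card (?A u w) + card (?A v w) = card (?A u w \<union> ?A v w) + card (?A u w \<inter> ?A v w)"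
      by (intro card_Un_Int) (use finT in auto)
    ultimately show ?thesis using A[OF w] by linarith
  qed
  hence "(\<Sum>w\<in>Y u v. card (Y u w) + card (Y v w)) \<le> (\<Sum>w\<in>Y u v. card (?A u w \<union> ?A v w) + 1)"
    by (intro sum_mono) auto
  thus "(\<Sum>w\<in>Y u v. card (Y u w) + card (Y v w)) \<le>
      (\<Sum>T\<in>triangles E. card (lost_nbrs E u v T)) + card (Y u v)"
    unfolding swap by (simp only: sum.distrib) simp
qed

primrec greedy_count :: "nat \<Rightarrow> 'a set set \<Rightarrow> nat" where
  "greedy_count 0 E = 1"
| "greedy_count (Suc m) E = (\<Sum>T\<in>triangles E. greedy_count m (E - pairs T))"

definition packings :: "nat \<Rightarrow> 'a set set \<Rightarrow> 'a set set set" where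
  "packings m E = {P. P \<subseteq> triangles E \<and> card P = m \<and>
     (\<forall>S\<in>P. \<forall>T\<in>P. S \<noteq> T \<longrightarrow> pairs S \<inter> pairs T = {})}"

lemma finite_packings:
  assumes "finite V" "E \<subseteq> pairs V"
  shows "finite (packings m E)"
  by (rule finite_subset[of _ "Pow (triangles E)"])
    (use finite_triangles[OF assms] in \<open>auto simp: packings_def\<close>)

lemma greedy_count_le:
  assumes "finite V" "E \<subseteq> pairs V"
  shows "greedy_count m E \<le> fact m * card (packings m E)"
  using assms(2)
proof (induction m arbitrary: E)
  case 0
  have "packings 0 E = {{}}"
    using finite_triangles[OF assms(1) 0] finite_subset by (fastforce simp: packings_def)
  thus ?case by simp
next
  case (Suc m)
  let ?S = "SIGMA T:triangles E. packings m (E - pairs T)"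
  let ?R = "SIGMA P:packings (Suc m) E. P"
  have finT: "finite (triangles E)" using finite_triangles[OF assms(1) Suc.prems] .
  have finP: "finite (packings (Suc m) E)" using finite_packings[OF assms(1) Suc.prems] .
  have finPm: "finite (packings m (E - pairs T))" for T
    using finite_packings[OF assms(1)] Suc.prems by (metis Diff_subset subset_trans)
  have mem: "finite P" if "P \<in> packings (Suc m) E" for P
    using that finT finite_subset by (auto simp: packings_def)
  have nonempty: "pairs T \<noteq> {}" if "T \<in> triangles F" for T and F :: "'a set set"
    using that card_pairs_triangle[of T] by (auto simp: triangles_def)
  have new: "T \<notin> P" "finite P" if "T \<in> triangles E" "P \<in> packings m (E - pairs T)" for T P
  proof -
    show "T \<notin> P"
    proof
      assume "T \<in> P"
      hence "T \<in> triangles (E - pairs T)" using that by (auto simp: packings_def)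
      thus False using nonempty[of T "E - pairs T"] by (auto simp: triangles_def)
    qed
    have "P \<subseteq> triangles E" using that by (auto simp: packings_def triangles_def)
    thus "finite P" using finT finite_subset by blast
  qed
  have "greedy_count (Suc m) E \<le> (\<Sum>T\<in>triangles E. fact m * card (packings m (E - pairs T)))"
    by (simp, intro sum_mono Suc.IH) (use Suc.prems in auto)
  also have "\<dots> = fact m * card ?S"
    using finT finPm by (simp add: sum_distrib_left)
  also have "card ?S \<le> card ?R"
  proof (rule card_inj_on_le[where f = "\<lambda>(T, P). (insert T P, T)"])
    show "inj_on (\<lambda>(T, P). (insert T P, T)) ?S"
      using new by (auto simp: inj_on_def) (metis insert_ident)+
    show "(\<lambda>(T, P). (insert T P, T)) ` ?S \<subseteq> ?R"
    proof clarsimp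
      fix T P assume *: "T \<in> triangles E" "P \<in> packings m (E - pairs T)"
      hence "S \<in> triangles E \<and> pairs S \<inter> pairs T = {}" if "S \<in> P" for S
        using that by (auto simp: packings_def triangles_def)
      thus "insert T P \<in> packings (Suc m) E"
        using * new[OF *] by (auto simp: packings_def)
    qed
    show "finite ?R" using finP mem by auto
  qed
  also have "card ?R = (\<Sum>P\<in>packings (Suc m) E. card P)" using finP mem by (simp add: card_SigmaI)
  also have "\<dots> = (\<Sum>P\<in>packings (Suc m) E. Suc m)"
    by (intro sum.cong) (auto simp: packings_def)
  finally show ?case by (simp add: algebra_simps)
qed

lemma paving_of_packing:
  fixes n :: nat
  assumes n: "n \<ge> 4" and P: "P \<in> packings m (pairs {1..n})"
  defines "I \<equiv> {X. X \<subseteq> {1..n} \<and> card X \<le> 3 \<and> X \<notin> P}"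
  shows "paving_matroid {1..n} I" "matroid_rank I = 3"
proof -
  have P3: "card T = 3" if "T \<in> P" for T using that P by (auto simp: packings_def triangles_def)
  have uniq: "y = z" if "insert y X \<in> P" "insert z X \<in> P" "card X = 2" for X and y z :: nat
  proof (rule ccontr)
    assume "y \<noteq> z"
    have "y \<notin> X" "z \<notin> X" using P3 that by (metis insert_absorb numeral_eq_iff semiring_norm(89))+
    hence "insert y X \<noteq> insert z X" using \<open>y \<noteq> z\<close> by auto
    moreover have "X \<in> pairs (insert y X) \<inter> pairs (insert z X)" using that by (auto simp: pairs_def)
    moreover have "pairs S \<inter> pairs T = {}" if "S \<in> P" "T \<in> P" "S \<noteq> T" for S T
      using P that by (simp add: packings_def)
    ultimately show False using that by blast
  qed
  have fin: "finite X" if "X \<subseteq> {1..n}" for X using that finite_subset by blast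
  have small: "X \<in> I" if "X \<subseteq> {1..n}" "card X < 3" for X
    using that P3 by (auto simp: I_def)
  have exch: "\<exists>y\<in>Y - X. insert y X \<in> I" if X: "X \<in> I" and Y: "Y \<in> I" and lt: "card X < card Y" for X Y
  proof -
    have XY: "X \<subseteq> {1..n}" "Y \<subseteq> {1..n}" "card Y \<le> 3" using X Y by (auto simp: I_def)
    have "Y - X \<noteq> {}"
      using lt XY fin by (metis Diff_eq_empty_iff card_mono linorder_not_less)
    then obtain y where y: "y \<in> Y" "y \<notin> X" by auto
    show ?thesis
    proof (cases "card X < 2")
      case True
      hence "insert y X \<in> I" using XY y fin[OF XY(1)] by (intro small) auto
      thus ?thesis using y by auto
    next
      case False
      hence X2: "card X = 2" "card Y = 3" using lt XY by auto
      have ins: "insert z X \<in> I \<longleftrightarrow> insert z X \<notin> P" if "z \<in> Y - X" for z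
        using that XY X2 fin[OF XY(1)] by (auto simp: I_def)
      show ?thesis
      proof (cases "Y - X = {y}")
        case True
        hence "Y \<subseteq> insert y X" by auto
        hence "Y = insert y X" using X2 y fin[OF XY(1)] by (intro card_subset_eq) auto
        thus ?thesis using Y y by auto
      next
        case False
        then obtain z where "z \<in> Y - X" "z \<noteq> y" using y by auto
        thus ?thesis using uniq[of y X z] X2 ins[of y] ins[of z] y by auto
      qed
    qed
  qed
  have "matroid {1..n} I"
    unfolding matroid_def
  proof (intro conjI ballI allI impI)
    show "{} \<in> I" by (intro small) auto
    fix X Y assume X: "X \<in> I" and YX: "Y \<subseteq> X"
    have X': "X \<subseteq> {1..n}" "card X \<le> 3" "finite X" using X fin by (auto simp: I_def)
    show "Y \<in> I"
    proof (cases "Y = X")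
      case False
      hence "card Y < card X" using YX X' by (intro psubset_card_mono) auto
      thus ?thesis using YX X' by (intro small) auto
    qed (use X in simp)
  qed (use exch in \<open>auto simp: I_def\<close>)
  moreover have rank: "matroid_rank I = 3"
  proof -
    have "{1, 2, 3} \<in> I \<or> {1, 2, 4} \<in> I"
      using uniq[of 3 "{1, 2}" 4] n by (auto simp: I_def insert_commute)
    moreover have "card {1, 2, 3::nat} = 3" "card {1, 2, 4::nat} = 3" by auto
    ultimately have "3 \<in> card ` I" by (metis image_eqI)
    moreover have "finite I" by (rule finite_subset[of _ "Pow {1..n}"]) (auto simp: I_def)
    ultimately show ?thesis
      unfolding matroid_rank_def by (intro Max_eqI) (auto simp: I_def)
  qed
  ultimately show "paving_matroid {1..n} I" "matroid_rank I = 3"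
    using small by (auto simp: paving_matroid_def)
qed

lemma card_packings_le_num_paving:
  assumes n: "n \<ge> 4"
  shows "card (packings m (pairs {1..n})) \<le> num_paving n 3"
  unfolding num_paving_def
proof (rule card_inj_on_le[where f = "\<lambda>P. {X. X \<subseteq> {1..n} \<and> card X \<le> 3 \<and> X \<notin> P}"])
  show "inj_on (\<lambda>P. {X. X \<subseteq> {1..n} \<and> card X \<le> 3 \<and> X \<notin> P}) (packings m (pairs {1..n}))"
  proof (rule inj_onI)
    fix P Q assume P: "P \<in> packings m (pairs {1..n})" and Q: "Q \<in> packings m (pairs {1..n})"
      and eq: "{X. X \<subseteq> {1..n} \<and> card X \<le> 3 \<and> X \<notin> P} = {X. X \<subseteq> {1..n} \<and> card X \<le> 3 \<and> X \<notin> Q}"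
    have "T \<subseteq> {1..n} \<and> card T \<le> 3" if "T \<in> P \<union> Q" for T
      using that P Q triangle_subset[of "pairs {1..n}" "{1..n}" T]
      by (auto simp: packings_def triangles_def)
    thus "P = Q" using eq by blast
  qed
  have "{I. paving_matroid {1..n} I \<and> matroid_rank I = 3} \<subseteq> Pow (Pow {1..n})"
    by (auto simp: paving_matroid_def matroid_def)
  thus "finite {I. paving_matroid {1..n} I \<and> matroid_rank I = 3}"
    by (rule finite_subset) auto
qed (use paving_of_packing[OF n] in blast)

section \<open>The greedy process\<close>

lemma exp_le_quadratic:
  fixes x :: real
  assumes "\<bar>x\<bar> \<le> 1"
  shows "exp x \<le> 1 + x + x\<^sup>2"
proof (cases "x \<ge> 0")
  case True
  thus ?thesis using assms exp_bound[of x] by simp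
next
  case False
  define y where "y = -x"
  have y: "0 < y" "y \<le> 1" using False assms by (auto simp: y_def)
  have "exp x = 1 / exp y" by (simp add: y_def exp_minus field_simps)
  also have "\<dots> \<le> 1 / (1 + y)" using y exp_ge_add_one_self[of y] by (intro divide_left_mono) auto
  also have "\<dots> \<le> 1 - y + y\<^sup>2"
  proof -
    have "(1 - y + y\<^sup>2) * (1 + y) = 1 + y ^ 3" by (simp add: algebra_simps power2_eq_square power3_eq_cube)
    hence "1 \<le> (1 - y + y\<^sup>2) * (1 + y)" using y by simp
    thus ?thesis using y by (simp add: pos_divide_le_eq)
  qed
  finally show ?thesis by (simp add: y_def)
qed

lemma sum_exp_le:
  fixes X :: "'b \<Rightarrow> real"
  assumes fin: "finite S" and X: "\<And>T. T \<in> S \<Longrightarrow> 0 \<le> X T \<and> X T \<le> 2" and s: "\<bar>s\<bar> \<le> 1/2"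
  shows "(\<Sum>T\<in>S. exp (s * X T)) \<le> card S * exp ((s + 2 * s\<^sup>2) * (sum X S / card S))"
proof (cases "S = {}")
  case False
  hence c: "real (card S) > 0" using fin by (simp add: card_gt_0_iff)
  have "(\<Sum>T\<in>S. exp (s * X T)) \<le> (\<Sum>T\<in>S. 1 + (s + 2 * s\<^sup>2) * X T)"
  proof (rule sum_mono)
    fix T assume T: "T \<in> S"
    have "\<bar>s\<bar> * \<bar>X T\<bar> \<le> 1/2 * 2" using X[OF T] s by (intro mult_mono) auto
    hence "exp (s * X T) \<le> 1 + s * X T + (s * X T)\<^sup>2"
      by (intro exp_le_quadratic) (simp add: abs_mult)
    also have "(s * X T)\<^sup>2 = s\<^sup>2 * (X T * X T)" by (simp add: power2_eq_square)
    also have "\<dots> \<le> s\<^sup>2 * (2 * X T)" using X[OF T] by (intro mult_left_mono mult_right_mono) auto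
    finally show "exp (s * X T) \<le> 1 + (s + 2 * s\<^sup>2) * X T" by (simp add: algebra_simps)
  qed
  also have "\<dots> = card S * (1 + (s + 2 * s\<^sup>2) * (sum X S / card S))"
  proof -
    have "(\<Sum>T\<in>S. 1 + a * X T) = card S * (1 + a * (sum X S / card S))" for a
      using c by (simp add: sum.distrib sum_distrib_left[symmetric] distrib_left)
    thus ?thesis .
  qed
  also have "\<dots> \<le> card S * exp ((s + 2 * s\<^sup>2) * (sum X S / card S))"
    by (intro mult_left_mono exp_ge_add_one_self) auto
  finally show ?thesis .
qed auto

text \<open>If all codegrees are within \<open>n e\<close> of \<open>p\<^sup>2 n\<close>, the drift of a codegree is off by at most
  \<open>48 e / (p n)\<close>. A step lowers \<open>p\<close> by \<open>6 / n\<^sup>2\<close>, so with exponent 10 the allowance \<open>n e\<close> grows by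
  at least \<open>60 e / (p n)\<close>, which also leaves room for the second-order term of the exponential.\<close>

definition tolerance :: "real \<Rightarrow> real \<Rightarrow> real" where
  "tolerance l p = 5 * l / p ^ 10"

lemma tolerance_increment:
  assumes l: "0 < l" and h: "0 < h" "h < p"
  shows "tolerance l p + 10 * h * tolerance l p / p \<le> tolerance l (p - h)"
proof -
  define x where "x = h / p"
  have x: "0 < x" "x < 1" using h by (auto simp: x_def)
  have "1 + 10 * x \<le> (1 + x) ^ 10" using Bernoulli_inequality[of x 10] x by simp
  hence "(1 + 10 * x) * (1 - x) ^ 10 \<le> (1 + x) ^ 10 * (1 - x) ^ 10"
    using x by (intro mult_right_mono) auto
  also have "\<dots> = (1 - x\<^sup>2) ^ 10"
    by (simp add: power_mult_distrib[symmetric] algebra_simps power2_eq_square)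
  also have "\<dots> \<le> 1" using x by (intro power_le_one) (auto simp: power_le_one)
  finally have "1 + 10 * x \<le> 1 / (1 - x) ^ 10" using x by (simp add: pos_le_divide_eq)
  hence "tolerance l p * (1 + 10 * x) \<le> tolerance l p * (1 / (1 - x) ^ 10)"
    using l h by (intro mult_left_mono) (auto simp: tolerance_def)
  also have "\<dots> = 5 * l / (p * (1 - x)) ^ 10" by (simp add: tolerance_def power_mult_distrib)
  also have "p * (1 - x) = p - h" using h by (simp add: x_def field_simps)
  finally have "tolerance l p * (1 + 10 * x) \<le> tolerance l (p - h)" by (simp add: tolerance_def)
  thus ?thesis by (simp add: x_def distrib_left mult.commute mult.left_commute)
qed

lemma exponent_nonpos:
  fixes n l p X :: real
  defines "e \<equiv> tolerance l" and "p' \<equiv> p - 6 / n\<^sup>2"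
  assumes n: "n > 0" and l: "0 < l" and ln2: "3 \<le> l * n\<^sup>2" and p: "6 / n\<^sup>2 < p" "p \<le> 1"
    and e_small: "e p \<le> p\<^sup>2 / 10"
    and X: "\<bar>X - 12 * p / n\<bar> \<le> 48 * e p / (p * n)"
  shows "(-1 + 2 * l) * X + n * (p\<^sup>2 - p'\<^sup>2) - n * (e p' - e p) \<le> 0"
    and "(1 + 2 * l) * X - n * (p\<^sup>2 - p'\<^sup>2) - n * (e p' - e p) \<le> 0"
proof -
  have p0: "p > 0" using p n by (metis divide_pos_pos less_trans zero_less_numeral zero_less_power)
  define q where "q = e p / (p * n)"
  have "10 * (6 / n\<^sup>2) * e p / p \<le> e p' - e p"
    using tolerance_increment[of l "6 / n\<^sup>2" p] l n p by (simp add: e_def p'_def)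
  hence "n * (10 * (6 / n\<^sup>2) * e p / p) \<le> n * (e p' - e p)" using n by (intro mult_left_mono) auto
  also have "n * (10 * (6 / n\<^sup>2) * e p / p) = 60 * q" using n p0 by (simp add: q_def field_simps power2_eq_square)
  finally have inc: "60 * q \<le> n * (e p' - e p)" .
  have sq: "n * (p\<^sup>2 - p'\<^sup>2) = 12 * p / n - 36 / n ^ 3"
    using n by (simp add: p'_def power2_eq_square power3_eq_cube field_simps)
  have "q \<le> p / n / 10"
  proof -
    have "q \<le> (p\<^sup>2 / 10) / (p * n)" unfolding q_def using e_small p0 n by (intro divide_right_mono) auto
    thus ?thesis using p0 n by (simp add: power2_eq_square)
  qed
  moreover have X': "X \<le> 12 * (p / n) + 48 * q" "X \<ge> 12 * (p / n) - 48 * q" using X by (auto simp: q_def abs_le_iff)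
  moreover have "p / n \<le> 1 / n" using p n by (intro divide_right_mono) auto
  ultimately have "X \<le> 24 / n" by simp
  hence lX: "l * X \<le> l * (24 / n)" using l by (intro mult_left_mono) auto
  have "5 * l \<le> e p / p"
  proof -
    have "p ^ 11 \<le> 1" using p p0 by (intro power_le_one) auto
    hence "5 * l \<le> 5 * l / p ^ 11" using l p0 by (simp add: pos_le_divide_eq)
    also have "\<dots> = e p / p" by (simp add: e_def tolerance_def eval_nat_numeral)
    finally show ?thesis .
  qed
  hence "5 * l / n \<le> e p / p / n" using n by (intro divide_right_mono) auto
  hence q: "5 * (l / n) \<le> q" by (simp add: q_def)
  have "3 / n ^ 3 \<le> l * n\<^sup>2 / n ^ 3" using ln2 n by (intro divide_right_mono) auto
  hence n3: "3 / n ^ 3 \<le> l / n" using n by (simp add: power2_eq_square power3_eq_cube)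
  have split: "36 / n ^ 3 = 12 * (3 / n ^ 3)" "12 * p / n = 12 * (p / n)" "l * (24 / n) = 24 * (l / n)" by auto
  have n3': "0 \<le> 3 / n ^ 3" using n by simp
  show "(-1 + 2 * l) * X + n * (p\<^sup>2 - p'\<^sup>2) - n * (e p' - e p) \<le> 0"
    using inc X' lX q n3 n3' unfolding sq split by (simp only: distrib_right)
  show "(1 + 2 * l) * X - n * (p\<^sup>2 - p'\<^sup>2) - n * (e p' - e p) \<le> 0"
    using inc X' lX q n3 n3' unfolding sq split by (simp only: distrib_right)
qed

lemma mean_bound:
  fixes W mu eta Q S Y :: real
  assumes W: "W > 0" and eta: "1/2 \<le> eta" "10 * eta \<le> mu"
    and Q: "W / 6 * (mu - eta) \<le> Q" "Q \<le> W / 6 * (mu + eta)"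
    and Y: "mu - eta \<le> Y" "Y \<le> mu + eta"
    and S: "Y * (2 * (mu - eta) - 1) \<le> S" "S \<le> Y * (2 * (mu + eta))"
  shows "\<bar>S / Q - 12 * mu / W\<bar> \<le> 48 * eta / W"
proof -
  have "0 < W / 6 * (mu - eta)" using W eta by simp
  hence Q0: "Q > 0" using Q by linarith
  have "S \<le> (mu + eta) * (2 * (mu + eta))"
    using eta by (intro order.trans[OF S(2)] mult_right_mono Y) auto
  also have "\<dots> \<le> 2 * (mu + 4 * eta) * (mu - eta)"
  proof -
    have "5 * eta * eta \<le> mu * eta" using eta by (intro mult_right_mono) auto
    thus ?thesis by (simp add: algebra_simps)
  qed
  also have "\<dots> = (12 * mu / W + 48 * eta / W) * (W / 6 * (mu - eta))"
    using W by (simp add: field_simps)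
  also have "\<dots> \<le> (12 * mu / W + 48 * eta / W) * Q"
    using W eta by (intro mult_left_mono Q) auto
  finally have up: "S / Q \<le> 12 * mu / W + 48 * eta / W" using Q0 by (simp add: pos_divide_le_eq)
  have "(12 * mu / W - 48 * eta / W) * Q \<le> (12 * mu / W - 48 * eta / W) * (W / 6 * (mu + eta))"
    using W eta by (intro mult_left_mono Q) (auto simp: divide_right_mono)
  also have "\<dots> = 2 * (mu - 4 * eta) * (mu + eta)"
    using W by (simp add: field_simps)
  also have "\<dots> \<le> (mu - eta) * (2 * mu - 4 * eta)"
    by (simp add: algebra_simps)
  also have "\<dots> \<le> (mu - eta) * (2 * (mu - eta) - 1)"
    using eta by (intro mult_left_mono) auto
  also have "\<dots> \<le> Y * (2 * (mu - eta) - 1)" using eta by (intro mult_right_mono Y) auto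
  also have "\<dots> \<le> S" by (rule S)
  finally have "12 * mu / W - 48 * eta / W \<le> S / Q" using Q0 by (simp add: pos_le_divide_eq)
  thus ?thesis using up by (simp add: abs_le_iff)
qed

definition density :: "'a set \<Rightarrow> 'a set set \<Rightarrow> real" where
  "density V E = 2 * card E / (real (card V))\<^sup>2"

text \<open>The terms of \<open>potential\<close> are exponential moments of the two-sided deviation of codegrees
  from \<open>p\<^sup>2 n\<close>, discounted by the tolerance. It is a supermartingale of the random greedy
  process as long as it is below 1, and being below 1 forces all codegrees to be close to
  \<open>p\<^sup>2 n\<close>.\<close>

definition excess :: "real \<Rightarrow> real \<Rightarrow> real \<Rightarrow> real \<Rightarrow> real" where
  "excess n l p y = exp (l * (y - n * p\<^sup>2 - n * tolerance l p)) + exp (l * (n * p\<^sup>2 - y - n * tolerance l p))"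

definition potential :: "real \<Rightarrow> 'a set \<Rightarrow> 'a set set \<Rightarrow> real" where
  "potential l V E = (\<Sum>(u, v) | u \<in> V \<and> v \<in> V \<and> u \<noteq> v.
     excess (card V) l (density V E) (card (common_nbrs E u v)))"

lemma excess_nonneg: "0 \<le> excess n l p y"
  by (simp add: excess_def)

lemma excess_less_1D:
  assumes "excess n l p y < 1" "l > 0"
  shows "\<bar>y - n * p\<^sup>2\<bar> \<le> n * tolerance l p"
proof -
  have "exp (l * (y - n * p\<^sup>2 - n * tolerance l p)) < 1" "exp (l * (n * p\<^sup>2 - y - n * tolerance l p)) < 1"
    using assms(1) exp_gt_zero[of "l * (y - n * p\<^sup>2 - n * tolerance l p)"]
      exp_gt_zero[of "l * (n * p\<^sup>2 - y - n * tolerance l p)"] unfolding excess_def by linarith+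
  hence "l * (y - n * p\<^sup>2 - n * tolerance l p) < 0" "l * (n * p\<^sup>2 - y - n * tolerance l p) < 0"
    by simp_all
  thus ?thesis using assms(2) by (simp add: mult_less_0_iff abs_le_iff)
qed

lemma potential_less_1D:
  assumes V: "finite V" and l: "l > 0" and pot: "potential l V E < 1"
    and uv: "u \<in> V" "v \<in> V" "u \<noteq> v"
  shows "\<bar>card (common_nbrs E u v) - card V * (density V E)\<^sup>2\<bar> \<le> card V * tolerance l (density V E)"
proof (rule excess_less_1D)
  have fin: "finite {(u, v). u \<in> V \<and> v \<in> V \<and> u \<noteq> v}"
    by (rule finite_subset[of _ "V \<times> V"]) (use V in auto)
  have "(\<lambda>(u, v). excess (card V) l (density V E) (card (common_nbrs E u v))) (u, v)
      \<le> potential l V E"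
    unfolding potential_def
    by (rule member_le_sum[OF _ _ fin]) (use uv in \<open>auto simp: excess_nonneg\<close>)
  thus "excess (card V) l (density V E) (card (common_nbrs E u v)) < 1" using pot by simp
qed (rule l)

lemma sum_excess_le:
  fixes X :: "'b \<Rightarrow> real"
  assumes fin: "finite S" and X: "\<And>T. T \<in> S \<Longrightarrow> 0 \<le> X T \<and> X T \<le> 2" and l: "0 < l" "l \<le> 1/2"
    and n: "n > 0" and ln2: "3 \<le> l * n\<^sup>2" and p: "6 / n\<^sup>2 < p" "p \<le> 1"
    and e_small: "tolerance l p \<le> p\<^sup>2 / 10"
    and mean: "\<bar>sum X S / card S - 12 * p / n\<bar> \<le> 48 * tolerance l p / (p * n)"
  shows "(\<Sum>T\<in>S. excess n l (p - 6 / n\<^sup>2) (y - X T)) \<le> card S * excess n l p y"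
proof -
  define p' where "p' = p - 6 / n\<^sup>2"
  define e where "e = tolerance l p"
  define e' where "e' = tolerance l p'"
  define m where "m = sum X S / card S"
  note ex = exponent_nonpos[OF n l(1) ln2 p e_small mean, folded m_def p'_def, folded e_def e'_def]
  have "(\<Sum>T\<in>S. exp (l * (y - X T - n * p'\<^sup>2 - n * e'))) =
      exp (l * (y - n * p\<^sup>2 - n * e)) * exp (l * (n * (p\<^sup>2 - p'\<^sup>2) - n * (e' - e))) * (\<Sum>T\<in>S. exp (-l * X T))"
    unfolding sum_distrib_left exp_add[symmetric]
    by (intro sum.cong refl arg_cong[where f = exp]) (simp add: algebra_simps)
  also have "\<dots> \<le> exp (l * (y - n * p\<^sup>2 - n * e)) * exp (l * (n * (p\<^sup>2 - p'\<^sup>2) - n * (e' - e))) *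
      (card S * exp ((-l + 2 * (-l)\<^sup>2) * m))"
    unfolding m_def using l by (intro mult_left_mono sum_exp_le fin X) auto
  also have "\<dots> = card S * exp (l * (y - n * p\<^sup>2 - n * e)) * 
      exp (l * ((-1 + 2 * l) * m + n * (p\<^sup>2 - p'\<^sup>2) - n * (e' - e)))"
    by (simp add: exp_add[symmetric] algebra_simps power2_eq_square)
  also have "\<dots> \<le> card S * exp (l * (y - n * p\<^sup>2 - n * e)) * 1"
    using ex(1) l by (intro mult_left_mono) (auto simp: mult_le_0_iff)
  finally have A: "(\<Sum>T\<in>S. exp (l * (y - X T - n * p'\<^sup>2 - n * e'))) \<le> card S * exp (l * (y - n * p\<^sup>2 - n * e))"
    by simp
  have "(\<Sum>T\<in>S. exp (l * (n * p'\<^sup>2 - (y - X T) - n * e'))) =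
      exp (l * (n * p\<^sup>2 - y - n * e)) * exp (l * (- n * (p\<^sup>2 - p'\<^sup>2) - n * (e' - e))) * (\<Sum>T\<in>S. exp (l * X T))"
    unfolding sum_distrib_left exp_add[symmetric]
    by (intro sum.cong refl arg_cong[where f = exp]) (simp add: algebra_simps)
  also have "\<dots> \<le> exp (l * (n * p\<^sup>2 - y - n * e)) * exp (l * (- n * (p\<^sup>2 - p'\<^sup>2) - n * (e' - e))) *
      (card S * exp ((l + 2 * l\<^sup>2) * m))"
    unfolding m_def using l by (intro mult_left_mono sum_exp_le fin X) auto
  also have "\<dots> = card S * exp (l * (n * p\<^sup>2 - y - n * e)) * 
      exp (l * ((1 + 2 * l) * m - n * (p\<^sup>2 - p'\<^sup>2) - n * (e' - e)))"
    by (simp add: exp_add[symmetric] algebra_simps power2_eq_square)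
  also have "\<dots> \<le> card S * exp (l * (n * p\<^sup>2 - y - n * e)) * 1"
    using ex(2) l by (intro mult_left_mono) (auto simp: mult_le_0_iff)
  finally have B: "(\<Sum>T\<in>S. exp (l * (n * p'\<^sup>2 - (y - X T) - n * e'))) \<le> card S * exp (l * (n * p\<^sup>2 - y - n * e))"
    by simp
  show ?thesis
    using A B by (simp add: excess_def sum.distrib e_def e'_def p'_def distrib_left)
qed

lemma card_triangles_bounds:
  fixes mu eta :: real
  assumes V: "finite V" and E: "E \<subseteq> pairs V"
    and good: "\<And>u v. u \<in> V \<Longrightarrow> v \<in> V \<Longrightarrow> u \<noteq> v \<Longrightarrow> \<bar>card (common_nbrs E u v) - mu\<bar> \<le> eta"
  shows "card E * (mu - eta) \<le> 3 * card (triangles E)" "3 * card (triangles E) \<le> card E * (mu + eta)"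
proof -
  have 3: "3 * real (card (triangles E)) = (\<Sum>e\<in>E. real (card {T \<in> triangles E. e \<subseteq> T}))"
    using sum_triangles_through_edges[OF V E] by (metis of_nat_mult of_nat_numeral of_nat_sum)
  have b: "mu - eta \<le> card {T \<in> triangles E. e \<subseteq> T} \<and> card {T \<in> triangles E. e \<subseteq> T} \<le> mu + eta"
    if "e \<in> E" for e
  proof -
    have "e \<in> pairs V" using that E by blast
    then obtain u v where uv: "e = {u, v}" "u \<noteq> v" "u \<in> V" "v \<in> V" by (rule pairsE)
    hence "card {T \<in> triangles E. e \<subseteq> T} = card (common_nbrs E u v)"
      using card_triangles_through[OF E] that by simp
    thus ?thesis using good[OF uv(3,4,2)] by (auto simp: abs_le_iff)
  qed
  show "card E * (mu - eta) \<le> 3 * card (triangles E)" 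
    using sum_bounded_below[of E "mu - eta" "\<lambda>e. real (card {T \<in> triangles E. e \<subseteq> T})"] b 3 by simp
  show "3 * card (triangles E) \<le> card E * (mu + eta)"
    using sum_bounded_above[of E "\<lambda>e. real (card {T \<in> triangles E. e \<subseteq> T})" "mu + eta"] b 3 by simp
qed

lemma sum_lost_nbrs_bounds:
  fixes mu eta :: real
  assumes V: "finite V" and E: "E \<subseteq> pairs V"
    and good: "\<And>u v. u \<in> V \<Longrightarrow> v \<in> V \<Longrightarrow> u \<noteq> v \<Longrightarrow> \<bar>card (common_nbrs E u v) - mu\<bar> \<le> eta"
    and uv: "u \<in> V" "v \<in> V" "u \<noteq> v"
  defines "S \<equiv> (\<Sum>T\<in>triangles E. real (card (lost_nbrs E u v T)))"
  shows "card (common_nbrs E u v) * (2 * (mu - eta) - 1) \<le> S"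
    "S \<le> card (common_nbrs E u v) * (2 * (mu + eta))"
proof -
  let ?Y = "common_nbrs E"
  define R where "R = (\<Sum>w\<in>?Y u v. real (card (?Y u w)) + real (card (?Y v w)))"
  have R: "R = real (\<Sum>w\<in>?Y u v. card (?Y u w) + card (?Y v w))" by (simp add: R_def)
  have S: "S = real (\<Sum>T\<in>triangles E. card (lost_nbrs E u v T))" by (simp add: S_def)
  have SR: "S \<le> R" "R \<le> S + card (?Y u v)"
    unfolding R S using sum_card_lost_nbrs[OF V E uv(3)] by (simp_all only: of_nat_le_iff of_nat_add[symmetric])
  have b: "2 * (mu - eta) \<le> real (card (?Y u w)) + real (card (?Y v w))"
      "real (card (?Y u w)) + real (card (?Y v w)) \<le> 2 * (mu + eta)" if w: "w \<in> ?Y u v" for w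
  proof -
    have "w \<in> V" "w \<noteq> u" "w \<noteq> v" using common_nbrs_subset[OF E] w by blast+
    hence "\<bar>card (?Y u w) - mu\<bar> \<le> eta" "\<bar>card (?Y v w) - mu\<bar> \<le> eta" using good uv by auto
    thus "2 * (mu - eta) \<le> real (card (?Y u w)) + real (card (?Y v w))"
      "real (card (?Y u w)) + real (card (?Y v w)) \<le> 2 * (mu + eta)" by (auto simp: abs_le_iff)
  qed
  have "card (?Y u v) * (2 * (mu - eta)) \<le> R"
    unfolding R_def using b(1) by (intro sum_bounded_below)
  thus "card (?Y u v) * (2 * (mu - eta) - 1) \<le> S" using SR(2) by (simp add: algebra_simps)
  have "R \<le> card (?Y u v) * (2 * (mu + eta))"
    unfolding R_def using b(2) by (intro sum_bounded_above)
  thus "S \<le> card (?Y u v) * (2 * (mu + eta))" using SR(1) by simp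
qed

lemma density_remove:
  assumes V: "finite V" and E: "E \<subseteq> pairs V" and T: "T \<in> triangles E"
  shows "density V (E - pairs T) = density V E - 6 / (real (card V))\<^sup>2"
proof -
  have T': "card T = 3" "pairs T \<subseteq> E" using T by (auto simp: triangles_def)
  have "finite E" using V E finite_subset finite_pairs by blast
  hence "card (E - pairs T) = card E - 3" "3 \<le> card E"
    using T' card_pairs_triangle[of T] finite_pairs_triangle[of T] card_mono[of E "pairs T"]
    by (auto simp: card_Diff_subset)
  thus ?thesis by (simp add: density_def of_nat_diff diff_divide_distrib)
qed

lemma density_le_1:
  assumes V: "finite V" and E: "E \<subseteq> pairs V"
  shows "density V E \<le> 1"
proof -
  have "card E \<le> card V choose 2" using card_mono[OF finite_pairs[OF V] E] card_pairs[OF V] by simp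
  also have "2 * (card V choose 2) \<le> (card V)\<^sup>2"
    by (simp add: choose_two power2_eq_square) (metis diff_le_self div_times_less_eq_dividend dual_order.trans mult.commute mult_le_mono2)
  finally have "2 * card E \<le> (card V)\<^sup>2" by simp
  hence "2 * real (card E) \<le> (real (card V))\<^sup>2" by (metis of_nat_le_iff of_nat_mult of_nat_numeral of_nat_power)
  thus ?thesis by (cases "card V = 0") (auto simp: density_def divide_le_eq)
qed

lemma potential_supermartingale:
  fixes l :: real
  defines "e \<equiv> tolerance l"
  assumes V: "finite V" and E: "E \<subseteq> pairs V" and l: "0 < l" "l \<le> 1/2"
    and ln: "1 \<le> 10 * l * card V" "3 \<le> l * (real (card V))\<^sup>2"
    and p: "6 / (real (card V))\<^sup>2 < density V E" and e_small: "e (density V E) \<le> (density V E)\<^sup>2 / 10"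
    and pot: "potential l V E < 1"
  shows "(\<Sum>T\<in>triangles E. potential l V (E - pairs T)) \<le> card (triangles E) * potential l V E"
proof -
  define n where "n = real (card V)"
  define p where "p = density V E"
  define mu where "mu = n * p\<^sup>2"
  define eta where "eta = n * e p"
  let ?A = "{(u, v). u \<in> V \<and> v \<in> V \<and> u \<noteq> v}"
  have n: "n > 0" using ln(1) by (cases "card V = 0") (auto simp: n_def)
  have p': "6 / n\<^sup>2 < p" "p \<le> 1" using p density_le_1[OF V E] by (auto simp: n_def p_def)
  have p0: "p > 0" using p'(1) n by (metis divide_pos_pos less_trans zero_less_numeral zero_less_power)
  have good: "\<bar>card (common_nbrs E u v) - mu\<bar> \<le> eta" if "u \<in> V" "v \<in> V" "u \<noteq> v" for u v
    using potential_less_1D[OF V l(1) pot that] by (simp add: mu_def eta_def p_def n_def e_def)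
  have eta: "1/2 \<le> eta"
  proof -
    have "p ^ 10 \<le> 1" using p' p0 by (intro power_le_one) auto
    hence "5 * l \<le> e p" using l p0 by (simp add: e_def tolerance_def pos_le_divide_eq)
    hence "n * (5 * l) \<le> eta" using n by (simp add: eta_def)
    thus ?thesis using ln(1) by (simp add: n_def mult.commute)
  qed
  have eta': "10 * eta \<le> mu" using e_small n by (simp add: eta_def mu_def p_def)
  have cE: "real (card E) = p * n\<^sup>2 / 2" using n by (simp add: p_def density_def n_def)
  have mean: "\<bar>(\<Sum>T\<in>triangles E. real (card (lost_nbrs E u v T))) / card (triangles E) - 12 * p / n\<bar>
      \<le> 48 * e p / (p * n)" if uv: "u \<in> V" "v \<in> V" "u \<noteq> v" for u v
  proof -
    define S where "S = (\<Sum>T\<in>triangles E. real (card (lost_nbrs E u v T)))"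
    have "\<bar>S / card (triangles E) - 12 * mu / (p * n\<^sup>2)\<bar> \<le> 48 * eta / (p * n\<^sup>2)"
    proof (rule mean_bound[OF _ eta eta'])
      show "0 < p * n\<^sup>2" using p0 n by simp
      show "p * n\<^sup>2 / 6 * (mu - eta) \<le> card (triangles E)" "card (triangles E) \<le> p * n\<^sup>2 / 6 * (mu + eta)"
        using card_triangles_bounds[OF V E good] by (simp_all add: cE)
      show "mu - eta \<le> card (common_nbrs E u v)" "card (common_nbrs E u v) \<le> mu + eta"
        using good[OF uv] by (auto simp: abs_le_iff)
      show "card (common_nbrs E u v) * (2 * (mu - eta) - 1) \<le> S"
        "S \<le> card (common_nbrs E u v) * (2 * (mu + eta))"
        using sum_lost_nbrs_bounds[OF V E good uv] by (simp_all add: S_def)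
    qed
    moreover have "12 * mu / (p * n\<^sup>2) = 12 * p / n" "48 * eta / (p * n\<^sup>2) = 48 * e p / (p * n)"
      using p0 n by (auto simp: mu_def eta_def power2_eq_square)
    ultimately show ?thesis by (simp add: S_def)
  qed
  have "(\<Sum>T\<in>triangles E. potential l V (E - pairs T)) =
      (\<Sum>T\<in>triangles E. \<Sum>(u, v)\<in>?A. excess n l (p - 6 / n\<^sup>2)
        (real (card (common_nbrs E u v)) - real (card (lost_nbrs E u v T))))"
    unfolding potential_def
  proof (intro sum.cong refl, clarsimp)
    fix T u v assume T: "T \<in> triangles E"
    have "real (card (common_nbrs (E - pairs T) u v)) =
        real (card (common_nbrs E u v)) - real (card (lost_nbrs E u v T))"
      using card_common_nbrs_remove[OF V E T, of u v] by simp
    thus "excess (card V) l (density V (E - pairs T)) (card (common_nbrs (E - pairs T) u v)) =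
        excess n l (p - 6 / n\<^sup>2) (real (card (common_nbrs E u v)) - real (card (lost_nbrs E u v T)))"
      using density_remove[OF V E T] by (simp add: n_def p_def)
  qed
  also have "\<dots> = (\<Sum>(u, v)\<in>?A. \<Sum>T\<in>triangles E. excess n l (p - 6 / n\<^sup>2)
        (real (card (common_nbrs E u v)) - real (card (lost_nbrs E u v T))))"
    by (subst sum.swap) (simp add: case_prod_unfold)
  also have "\<dots> \<le> (\<Sum>(u, v)\<in>?A. card (triangles E) * excess n l p (card (common_nbrs E u v)))"
  proof (rule sum_mono, clarify)
    fix u v assume uv: "u \<in> V" "v \<in> V" "u \<noteq> v"
    show "(\<Sum>T\<in>triangles E. excess n l (p - 6 / n\<^sup>2)
        (real (card (common_nbrs E u v)) - real (card (lost_nbrs E u v T))))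
      \<le> card (triangles E) * excess n l p (card (common_nbrs E u v))"
    proof (rule sum_excess_le)
      show "3 \<le> l * n\<^sup>2" using ln(2) by (simp add: n_def)
      show "tolerance l p \<le> p\<^sup>2 / 10" using e_small by (simp add: e_def p_def)
      show "\<bar>(\<Sum>T\<in>triangles E. real (card (lost_nbrs E u v T))) / card (triangles E) - 12 * p / n\<bar>
        \<le> 48 * tolerance l p / (p * n)" using mean[OF uv] by (simp add: e_def)
      fix T assume "T \<in> triangles E"
      thus "0 \<le> real (card (lost_nbrs E u v T)) \<and> real (card (lost_nbrs E u v T)) \<le> 2"
        using card_lost_nbrs_le[OF E, of T u v] by simp
    qed (use n l p' finite_triangles[OF V E] in auto)
  qed
  also have "\<dots> = card (triangles E) * potential l V E"
    by (simp add: potential_def sum_distrib_left case_prod_unfold n_def p_def)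
  finally show ?thesis .
qed

lemma greedy_count_ge:
  fixes l d :: real
  assumes V: "finite V" and l: "0 < l" "l \<le> 1/2"
    and ln: "1 \<le> 10 * l * card V" "3 \<le> l * (real (card V))\<^sup>2"
    and q: "6 / (real (card V))\<^sup>2 < q" and d: "5 * l / q ^ 12 \<le> d" "d \<le> 1/10"
  assumes "E \<subseteq> pairs V" and "q \<le> density V E - 6 * (real k - 1) / (real (card V))\<^sup>2"
  shows "(1 - potential l V E) *
      (\<Prod>i<k. (1 - d) / 6 * (card V * (density V E - 6 * real i / (real (card V))\<^sup>2)) ^ 3)
    \<le> greedy_count k E"
  using assms(9,10)
proof (induction k arbitrary: E)
  case 0
  have "0 \<le> potential l V E" unfolding potential_def
    by (intro sum_nonneg) (auto simp: excess_nonneg)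
  thus ?case by simp
next
  case (Suc k)
  define n where "n = real (card V)"
  define p where "p = density V E"
  define G where "G i = (1 - d) / 6 * (n * (p - 6 * real i / n\<^sup>2)) ^ 3" for i
  have n: "n > 0" using ln(1) by (cases "card V = 0") (auto simp: n_def)
  have q0: "q > 0" using q n by (metis divide_pos_pos less_trans n_def zero_less_numeral zero_less_power of_nat_power)
  have p_ge: "q \<le> p - 6 * real i / n\<^sup>2" if "i \<le> k" for i
  proof -
    have "6 * real i / n\<^sup>2 \<le> 6 * real k / n\<^sup>2" using that by (intro divide_right_mono) auto
    thus ?thesis using Suc.prems(2) by (simp add: p_def n_def)
  qed
  have pp: "q \<le> p" using p_ge[of 0] by simp
  have G_pos: "G i \<ge> 0" if "i \<le> k" for i
    using p_ge[OF that] q0 d n by (simp add: G_def)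
  show ?case
  proof (cases "potential l V E < 1")
    case False
    have "0 \<le> (\<Prod>i<Suc k. G i)" using G_pos by (intro prod_nonneg) auto
    hence "(1 - potential l V E) * (\<Prod>i<Suc k. G i) \<le> 0"
      using False by (intro mult_nonpos_nonneg) auto
    also have "0 \<le> real (greedy_count (Suc k) E)" by (rule of_nat_0_le_iff)
    finally show ?thesis by (simp only: G_def p_def n_def)
  next
    case True
    have tol: "tolerance l p \<le> d * p\<^sup>2"
    proof -
      have "5 * l \<le> d * q ^ 12" using d q0 by (simp add: pos_divide_le_eq)
      also have "\<dots> \<le> d * p ^ 12"
      proof (intro mult_left_mono power_mono)
        have "0 < 5 * l / q ^ 12" using l q0 by simp
        thus "0 \<le> d" using d by linarith
      qed (use pp q0 in auto)
      finally have "5 * l \<le> d * p\<^sup>2 * p ^ 10" by (simp add: power_add[symmetric] mult.assoc)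
      thus ?thesis using pp q0 by (simp add: tolerance_def pos_divide_le_eq)
    qed
    also have "\<dots> \<le> 1/10 * p\<^sup>2" using d by (intro mult_right_mono) auto
    finally have tol': "tolerance l p \<le> p\<^sup>2 / 10" by simp
    have sm: "(\<Sum>T\<in>triangles E. potential l V (E - pairs T)) \<le> card (triangles E) * potential l V E"
      by (rule potential_supermartingale[OF V Suc.prems(1) l ln _ _ True])
        (use pp q tol' in \<open>auto simp: p_def\<close>)
    have Q: "G 0 \<le> card (triangles E)"
    proof -
      have "card E * (n * p\<^sup>2 - n * tolerance l p) \<le> 3 * card (triangles E)"
        using card_triangles_bounds(1)[OF V Suc.prems(1)] potential_less_1D[OF V l(1) True]
        by (simp add: p_def n_def)
      moreover have "card E * (n * p\<^sup>2 - n * (d * p\<^sup>2)) \<le> card E * (n * p\<^sup>2 - n * tolerance l p)"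
        using tol n by (intro mult_left_mono) auto
      moreover have "real (card E) = p * n\<^sup>2 / 2" using n by (simp add: p_def density_def n_def)
      ultimately have "p * n\<^sup>2 / 2 * (n * p\<^sup>2 - n * (d * p\<^sup>2)) \<le> 3 * card (triangles E)" by simp
      thus ?thesis by (simp add: G_def power2_eq_square power3_eq_cube algebra_simps)
    qed
    define R where "R = (\<Prod>i<k. G (Suc i))"
    have R0: "0 \<le> R" unfolding R_def using G_pos by (intro prod_nonneg) auto
    have IH: "(1 - potential l V (E - pairs T)) * R \<le> greedy_count k (E - pairs T)" if T: "T \<in> triangles E" for T
    proof -
      have dens: "density V (E - pairs T) = p - 6 / n\<^sup>2"
        using density_remove[OF V Suc.prems(1) T] by (simp add: p_def n_def)
      have shift: "p - 6 / n\<^sup>2 - 6 * real i / n\<^sup>2 = p - 6 * real (Suc i) / n\<^sup>2" for i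
        by (simp add: add_divide_distrib algebra_simps)
      have "(1 - potential l V (E - pairs T)) *
        (\<Prod>i<k. (1 - d) / 6 * (card V * (density V (E - pairs T) - 6 * real i / (real (card V))\<^sup>2)) ^ 3)
        \<le> greedy_count k (E - pairs T)"
      proof (rule Suc.IH)
        show "E - pairs T \<subseteq> pairs V" using Suc.prems(1) by auto
        have "p - 6 / n\<^sup>2 - 6 * (real k - 1) / n\<^sup>2 = p - 6 * real k / n\<^sup>2"
          by (simp add: diff_divide_distrib algebra_simps)
        thus "q \<le> density V (E - pairs T) - 6 * (real k - 1) / (real (card V))\<^sup>2"
          using p_ge[of k] dens by (simp add: n_def)
      qed
      thus ?thesis unfolding dens R_def G_def n_def[symmetric] shift by simp
    qed
    have "(1 - potential l V E) * (\<Prod>i<Suc k. G i) = G 0 * ((1 - potential l V E) * R)"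
      unfolding prod.lessThan_Suc_shift R_def by (simp add: mult_ac)
    also have "\<dots> \<le> card (triangles E) * ((1 - potential l V E) * R)"
      using Q R0 True by (intro mult_right_mono) auto
    also have "\<dots> = (card (triangles E) - card (triangles E) * potential l V E) * R"
      by (simp add: algebra_simps)
    also have "\<dots> \<le> (card (triangles E) - (\<Sum>T\<in>triangles E. potential l V (E - pairs T))) * R"
      using sm R0 by (intro mult_right_mono) auto
    also have "\<dots> = (\<Sum>T\<in>triangles E. (1 - potential l V (E - pairs T)) * R)"
      by (simp add: sum_distrib_right[symmetric] sum_subtractf)
    also have "\<dots> \<le> (\<Sum>T\<in>triangles E. real (greedy_count k (E - pairs T)))"
      by (intro sum_mono IH)
    finally show ?thesis by (simp add: G_def p_def n_def)
  qed
qed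

section \<open>Lower bound\<close>

lemma sum_ln_ge:
  fixes a :: real
  assumes "real m < a"
  shows "m * ln a - a \<le> (\<Sum>i<m. ln (a - real i))"
proof -
  define F where "F x = x * ln x - x" for x :: real
  have "F a - F (a - real m) \<le> (\<Sum>i<m. ln (a - real i))"
    using assms
  proof (induction m)
    case (Suc m)
    define x where "x = a - real m"
    have x: "x > 1" using Suc.prems by (simp add: x_def)
    have "ln x - ln (x - 1) \<le> (x - (x - 1)) / (x - 1)" using x by (intro ln_diff_le) auto
    hence "(x - 1) * (ln x - ln (x - 1)) \<le> 1" using x by (simp add: pos_le_divide_eq mult.commute)
    hence "F x - F (x - 1) \<le> ln x" by (simp add: F_def algebra_simps)
    moreover have eq: "a - real (Suc m) = x - 1" by (simp add: x_def)
    ultimately show ?case using Suc unfolding eq by (simp add: x_def)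
  qed simp
  moreover have "F (a - real m) \<le> (a - real m) * ln a"
  proof -
    have "(a - real m) * ln (a - real m) \<le> (a - real m) * ln a"
      using assms by (intro mult_left_mono) auto
    thus ?thesis using assms unfolding F_def by linarith
  qed
  ultimately show ?thesis by (simp add: F_def algebra_simps)
qed

lemma fact_le_prod_diff:
  fixes a :: real
  assumes "real m \<le> a"
  shows "fact m \<le> (\<Prod>i<m. a - real i)"
proof -
  have "(fact m :: real) = (\<Prod>i<m. real (m - i))"
    by (simp add: fact_prod_rev atLeast0LessThan)
  also have "\<dots> \<le> (\<Prod>i<m. a - real i)"
    using assms by (intro prod_mono) (auto simp: of_nat_diff)
  finally show ?thesis .
qed

lemma card_pairs_real:
  assumes "finite V"
  shows "real (card (pairs V)) = card V * (real (card V) - 1) / 2"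
  using assms by (simp add: card_pairs choose_two_real)

lemma potential_complete_le:
  fixes l :: real
  assumes V: "finite V" and n: "card V \<ge> 2" and l: "l > 0"
  shows "potential l V (pairs V) \<le> 2 * (real (card V))\<^sup>2 * exp (l * (1 / card V - 5 * l * card V))"
proof -
  define n where "n = real (card V)"
  have n2: "n \<ge> 2" using assms by (simp add: n_def)
  define p where "p = density V (pairs V)"
  have p: "p = 1 - 1 / n"
    using card_pairs_real[OF V] assms n2 by (simp add: p_def density_def n_def[symmetric] power2_eq_square field_simps)
  have p01: "0 < p" "p \<le> 1" using n2 by (auto simp: p)
  have np: "n * p\<^sup>2 = n - 2 + 1 / n" using n2 by (simp add: p power2_eq_square field_simps)
  have "p ^ 10 \<le> 1" using p01 by (intro power_le_one) auto
  hence "5 * l \<le> tolerance l p" using l p01 by (simp add: tolerance_def pos_le_divide_eq)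
  hence tol: "5 * l * n \<le> n * tolerance l p" using n2 by (simp add: mult.commute)
  have ex: "excess n l p (card (common_nbrs (pairs V) u v)) \<le> 2 * exp (l * (1 / n - 5 * l * n))"
    if uv: "u \<in> V" "v \<in> V" "u \<noteq> v" for u v
  proof -
    have "common_nbrs (pairs V) u v = V - {u, v}"
      using uv by (auto simp: common_nbrs_def doubleton_in_pairs)
    hence "real (card (common_nbrs (pairs V) u v)) - n * p\<^sup>2 = - (1 / n)"
      unfolding np using uv V assms by (simp add: card_Diff_subset n_def of_nat_diff)
    moreover have "0 \<le> 1 / n" using n2 by simp
    ultimately have "card (common_nbrs (pairs V) u v) - n * p\<^sup>2 - n * tolerance l p \<le> 1 / n - 5 * l * n"
      "n * p\<^sup>2 - card (common_nbrs (pairs V) u v) - n * tolerance l p \<le> 1 / n - 5 * l * n"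
      using tol by linarith+
    hence "exp (l * (card (common_nbrs (pairs V) u v) - n * p\<^sup>2 - n * tolerance l p)) \<le> exp (l * (1 / n - 5 * l * n))"
      "exp (l * (n * p\<^sup>2 - card (common_nbrs (pairs V) u v) - n * tolerance l p)) \<le> exp (l * (1 / n - 5 * l * n))"
      using l by simp_all
    thus ?thesis unfolding excess_def by linarith
  qed
  let ?A = "{(u, v). u \<in> V \<and> v \<in> V \<and> u \<noteq> v}"
  have "potential l V (pairs V) \<le> (\<Sum>(u, v)\<in>?A. 2 * exp (l * (1 / n - 5 * l * n)))"
    unfolding potential_def using ex by (intro sum_mono) (auto simp: p_def n_def)
  also have "\<dots> = card ?A * (2 * exp (l * (1 / n - 5 * l * n)))" by (simp add: case_prod_unfold)
  also have "\<dots> \<le> n\<^sup>2 * (2 * exp (l * (1 / n - 5 * l * n)))"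
  proof (intro mult_right_mono)
    have "card ?A \<le> card (V \<times> V)" using V by (intro card_mono) auto
    thus "card ?A \<le> n\<^sup>2" by (simp add: card_cartesian_product n_def power2_eq_square flip: of_nat_mult)
  qed auto
  finally show ?thesis by (simp add: n_def)
qed

lemma ln_num_paving_3_ge:
  fixes n m :: nat and l d q :: real
  defines "a \<equiv> real n * (real n - 1) / 6"
  assumes n: "n \<ge> 4" and l: "0 < l" "l \<le> 1/2" and ln: "1 \<le> 10 * l * n" "3 \<le> l * (real n)\<^sup>2"
    and q: "6 / (real n)\<^sup>2 < q" "5 * l / q ^ 12 \<le> d" and d: "d \<le> 1/10"
    and pot: "2 * (real n)\<^sup>2 * exp (l * (1 / n - 5 * l * n)) \<le> 1/2"
    and m: "real m < a" "q \<le> 6 * (a - (real m - 1)) / (real n)\<^sup>2"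
  shows "m * (ln ((real n - 1)\<^sup>2 / n) + ln (1 - d)) - 2 * a - ln 2 \<le> ln (real (num_paving n 3))"
proof -
  let ?V = "{1..n}" and ?E = "pairs {1..n}"
  have dens: "density ?V ?E - 6 * x / (real n)\<^sup>2 = 6 * (a - x) / (real n)\<^sup>2" for x
    using card_pairs_real[of ?V] n by (simp add: density_def a_def field_simps)
  have "potential l ?V ?E \<le> 1/2" using potential_complete_le[of ?V l] n l pot by simp
  hence pot': "1/2 \<le> 1 - potential l ?V ?E" by simp
  define A where "A = (\<Prod>i<m. a - real i)"
  define B where "B = (\<Prod>i<m. (1 - d) * (36 / real n ^ 3) * (a - real i)\<^sup>2)"
  have pos: "a - real i > 0" if "i < m" for i using m that by simp
  have A: "A > 0" unfolding A_def using pos by (intro prod_pos) auto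
  have pos2: "0 < (1 - d) * (36 / real n ^ 3) * (a - real i)\<^sup>2" if "i < m" for i
    using pos[OF that] d n by (intro mult_pos_pos) auto
  have B: "B > 0" unfolding B_def using pos2 by (intro prod_pos) auto
  have ln3: "ln (x * y * z\<^sup>2) = ln x + ln y + 2 * ln z" if "0 < x" "0 < y" "0 < z" for x y z :: real
    using that by (simp add: ln_mult ln_realpow)
  have factor: "(1 - d) / 6 * (n * (density ?V ?E - 6 * real i / (real n)\<^sup>2)) ^ 3 =
      ((1 - d) * (36 / real n ^ 3) * (a - real i)\<^sup>2) * (a - real i)" for i
    unfolding dens using n by (simp add: field_simps power2_eq_square power3_eq_cube)
  have "(1 - potential l ?V ?E) *
      (\<Prod>i<m. (1 - d) / 6 * (card ?V * (density ?V ?E - 6 * real i / (real (card ?V))\<^sup>2)) ^ 3) \<le> greedy_count m ?E"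
    using l ln q d m dens[of "real m - 1"] by (intro greedy_count_ge[where q = q]) auto
  hence gc: "(1 - potential l ?V ?E) * (B * A) \<le> greedy_count m ?E"
    by (simp only: card_atLeastAtMost diff_Suc_1 factor A_def B_def prod.distrib[symmetric] add_diff_cancel_right' of_nat_power) 
  have "1/2 * (B * A) \<le> (1 - potential l ?V ?E) * (B * A)"
    using pot' A B by (intro mult_right_mono) auto
  also note gc
  also have "real (greedy_count m ?E) \<le> real (fact m * card (packings m ?E))"
    using greedy_count_le[of ?V ?E m] by (simp only: of_nat_le_iff) simp
  also have "\<dots> \<le> real (fact m * num_paving n 3)"
    using card_packings_le_num_paving[OF n, of m] by (simp only: of_nat_le_iff mult_le_mono2)
  also have "\<dots> = fact m * real (num_paving n 3)" by simp
  also have "\<dots> \<le> A * real (num_paving n 3)"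
    unfolding A_def using m by (intro mult_right_mono fact_le_prod_diff) auto
  finally have "1/2 * B \<le> real (num_paving n 3)" using A by (simp add: mult.commute)
  hence "ln (1/2 * B) \<le> ln (real (num_paving n 3))" using B by simp
  moreover have "ln (1/2 * B) = ln B - ln 2" using B by (simp add: ln_mult ln_div)
  moreover have "ln B = (\<Sum>i<m. (ln (1 - d) + ln (36 / real n ^ 3)) + 2 * ln (a - real i))"
  proof -
    have "ln B = (\<Sum>i<m. ln ((1 - d) * (36 / real n ^ 3) * (a - real i)\<^sup>2))"
      unfolding B_def using pos2 by (intro ln_prod finite_lessThan) (metis lessThan_iff less_irrefl)
    also have "\<dots> = (\<Sum>i<m. (ln (1 - d) + ln (36 / real n ^ 3)) + 2 * ln (a - real i))"
    proof (intro sum.cong refl)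
      fix i assume "i \<in> {..<m}"
      thus "ln ((1 - d) * (36 / real n ^ 3) * (a - real i)\<^sup>2) =
          (ln (1 - d) + ln (36 / real n ^ 3)) + 2 * ln (a - real i)"
        using pos[of i] d n by (intro ln3) auto
    qed
    finally show ?thesis .
  qed
  moreover have "\<dots> = m * (ln (1 - d) + ln (36 / real n ^ 3)) + 2 * (\<Sum>i<m. ln (a - real i))"
    by (simp add: sum.distrib sum_distrib_left)
  moreover have "m * ln a - a \<le> (\<Sum>i<m. ln (a - real i))" by (rule sum_ln_ge[OF m(1)])
  moreover have "ln (36 / real n ^ 3) + 2 * ln a = ln ((real n - 1)\<^sup>2 / n)"
  proof -
    have a0: "a > 0" using n by (simp add: a_def)
    have "ln (36 / real n ^ 3) + 2 * ln a = ln (36 / real n ^ 3 * a\<^sup>2)"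
      using ln3[of 1 "36 / real n ^ 3" a] a0 n by simp
    also have "36 / real n ^ 3 * a\<^sup>2 = (real n - 1)\<^sup>2 / n"
      using n by (simp add: a_def power2_eq_square power3_eq_cube)
    finally show ?thesis .
  qed
  hence "m * ln (36 / real n ^ 3) + 2 * (m * ln a) = m * ln ((real n - 1)\<^sup>2 / n)"
    by (metis distrib_left mult.left_commute)
  ultimately show ?thesis by (simp add: distrib_left)
qed

lemma eventually_ln_num_paving_3_ge:
  "\<exists>\<epsilon> :: nat \<Rightarrow> real. \<epsilon> \<in> o(\<lambda>_. 1) \<and>
     (\<forall>\<^sub>F n in at_top. real n * (real n - 1) / 6 * (ln (real n - 2) - 2 + \<epsilon> n) \<le> ln (real (num_paving n 3)))"
proof (intro exI conjI)
  define a where "a n = real n * (real n - 1) / 6" for n :: nat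
  define t where "t n = real n powr (-1/96)" for n :: nat
  define l where "l n = real n powr (-1/4)" for n :: nat
  define d where "d n = 20480 * real n powr (-1/8)" for n :: nat
  define B where "B n = ln ((real n - 1)\<^sup>2 / real n) + ln (1 - d n)" for n :: nat
  define \<epsilon> where "\<epsilon> n = (1 - t n - 1 / a n) * B n - ln 2 / a n - ln (real n - 2)" for n :: nat
  have "\<epsilon> \<longlonglongrightarrow> 0"
    unfolding \<epsilon>_def B_def a_def t_def d_def by real_asymp
  thus "\<epsilon> \<in> o(\<lambda>_. 1)" by (intro smalloI_tendsto) auto
  have d0: "d \<longlonglongrightarrow> 0" unfolding d_def by real_asymp
  have ev_d: "\<forall>\<^sub>F n in at_top. d n < 1/10" by (rule order_tendstoD[OF d0]) simp
  have "(\<lambda>n. 2 * (real n)\<^sup>2 * exp (l n * (1 / n - 5 * l n * n))) \<longlonglongrightarrow> 0"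
    unfolding l_def by real_asymp
  hence ev_pot: "\<forall>\<^sub>F n in at_top. 2 * (real n)\<^sup>2 * exp (l n * (1 / n - 5 * l n * n)) < 1/2"
    by (rule order_tendstoD) simp
  have l0: "l \<longlonglongrightarrow> 0" unfolding l_def by real_asymp
  have ev_l: "\<forall>\<^sub>F n in at_top. l n < 1/2" by (rule order_tendstoD[OF l0]) simp
  have ev_ln: "\<forall>\<^sub>F n in at_top. 1 \<le> 10 * l n * n" "\<forall>\<^sub>F n in at_top. 3 \<le> l n * (real n)\<^sup>2"
    unfolding l_def by real_asymp+
  have ev_t: "\<forall>\<^sub>F n in at_top. 6 / (real n)\<^sup>2 < t n / 2"
    unfolding t_def by real_asymp
  have ev_t1: "\<forall>\<^sub>F n in at_top. t n \<le> 1"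
    unfolding t_def by real_asymp
  have ev_B: "\<forall>\<^sub>F n in at_top. B n \<ge> 0"
    unfolding B_def d_def by real_asymp
  show "\<forall>\<^sub>F n in at_top. real n * (real n - 1) / 6 * (ln (real n - 2) - 2 + \<epsilon> n) \<le> ln (real (num_paving n 3))"
    using ev_d ev_pot ev_l ev_ln ev_t ev_t1 ev_B eventually_ge_at_top[of 4]
  proof eventually_elim
    case (elim n)
    have a0: "a n > 0" using elim by (simp add: a_def)
    have t0: "t n > 0" using elim by (simp add: t_def)
    define m where "m = nat \<lfloor>a n * (1 - t n)\<rfloor>"
    have nn: "0 \<le> a n * (1 - t n)" using a0 elim by simp
    have m_le: "real m \<le> a n * (1 - t n)" unfolding m_def using nn by (rule of_nat_floor)
    have m_ge: "a n * (1 - t n) - 1 \<le> real m" unfolding m_def using nn by linarith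
    have "a n * (1 - t n) < a n" using a0 t0 by (simp add: algebra_simps)
    hence m_less: "real m < a n" using m_le by linarith
    have "5 * l n / (t n / 2) ^ 12 = 20480 * (l n / t n ^ 12)" by (simp add: power_divide)
    also have "l n / t n ^ 12 = real n powr (-1/8)"
      using elim by (simp add: l_def t_def powr_power powr_diff[symmetric])
    finally have d: "5 * l n / (t n / 2) ^ 12 \<le> d n" by (simp add: d_def)
    have p0: "t n / 2 \<le> 6 * (a n - (real m - 1)) / (real n)\<^sup>2"
    proof -
      have "t n / 2 \<le> t n * (1 - 1 / n)" using t0 elim by (simp add: field_simps)
      also have "\<dots> = 6 * (a n * t n) / (real n)\<^sup>2" using elim by (simp add: a_def power2_eq_square field_simps)
      also have "\<dots> \<le> 6 * (a n - (real m - 1)) / (real n)\<^sup>2"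
        using m_le by (intro divide_right_mono) (auto simp: algebra_simps)
      finally show ?thesis .
    qed
    have "m * B n - 2 * a n - ln 2 \<le> ln (real (num_paving n 3))"
      unfolding B_def a_def
      by (rule ln_num_paving_3_ge[where l = "l n" and q = "t n / 2"])
        (use elim d p0 m_less in \<open>auto simp: a_def l_def\<close>)
    moreover have "(a n * (1 - t n) - 1) * B n \<le> m * B n" using m_ge elim by (intro mult_right_mono) auto
    moreover have "a n * (ln (real n - 2) - 2 + \<epsilon> n) = (a n * (1 - t n) - 1) * B n - 2 * a n - ln 2"
      using a0 by (simp add: \<epsilon>_def algebra_simps)
    ultimately show ?case by (simp add: a_def)
  qed
qed

lemma choose_3_real:
  assumes "n \<ge> 3"
  shows "1 / (real n - 2) * real (n choose 3) = real n * (real n - 1) / 6"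
proof -
  have "real (n choose 3) = real n * (real n - 1) * (real n - 2) / 6"
    by (simp add: binomial_gbinomial gbinomial_prod_rev numeral_eq_Suc)
  thus ?thesis using assms by (simp add: field_simps)
qed

theorem theorem6:
  fixes r :: nat
  assumes "r = 3"
  shows "(\<exists>\<epsilon> :: nat \<Rightarrow> real. \<epsilon> \<in> o(\<lambda>_. 1) \<and>
           (\<forall>\<^sub>F n in at_top.
              1 / (real n - real r + 1) * real (n choose r) * (ln (real n - real r + 1) - 2 + \<epsilon> n)
                \<le> ln (real (num_paving n r)))) \<and>
         (\<forall>\<^sub>F n in at_top.
            ln (real (num_paving n r))
              \<le> 1 / (real n - real r + 1) * real (n choose r) * (ln (real n - real r + 1) + 0.35))"
proof
  have arg: "real n - real 3 + 1 = real n - 2" for n by simp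
  obtain \<epsilon> :: "nat \<Rightarrow> real" where \<epsilon>: "\<epsilon> \<in> o(\<lambda>_. 1)" "\<forall>\<^sub>F n in at_top.
      real n * (real n - 1) / 6 * (ln (real n - 2) - 2 + \<epsilon> n) \<le> ln (real (num_paving n 3))"
    using eventually_ln_num_paving_3_ge by blast
  have "\<forall>\<^sub>F n in at_top. 1 / (real n - real r + 1) * real (n choose r) *
      (ln (real n - real r + 1) - 2 + \<epsilon> n) \<le> ln (real (num_paving n r))"
    using \<epsilon>(2) eventually_ge_at_top[of 3]
    by eventually_elim (simp only: assms choose_3_real arg)
  thus "\<exists>\<epsilon> :: nat \<Rightarrow> real. \<epsilon> \<in> o(\<lambda>_. 1) \<and> (\<forall>\<^sub>F n in at_top.
      1 / (real n - real r + 1) * real (n choose r) * (ln (real n - real r + 1) - 2 + \<epsilon> n)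
        \<le> ln (real (num_paving n r)))"
    using \<epsilon>(1) by blast
  show "\<forall>\<^sub>F n in at_top. ln (real (num_paving n r))
      \<le> 1 / (real n - real r + 1) * real (n choose r) * (ln (real n - real r + 1) + 0.35)"
    using eventually_ln_num_paving_3_le eventually_ge_at_top[of 3]
    by eventually_elim (simp only: assms choose_3_real arg)
qed

end
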